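(* Let $1\leq p\leq+\infty$ and $1\leq q<+\infty$. Polynomials (in the complex variable $z$) are dense in $RM(p,q)$. In particular, $RM(p,q)$ is a separable space.
   Context: $\mathbb{D}$ is the open unit disc of $\mathbb{C}$ and $\mathcal{H}(\mathbb{D})$ is the space of holomorphic functions on $\mathbb{D}$. For $q<+\infty$, $RM(p,q)=\{f\in\mathcal{H}(\mathbb{D}):\rho_{p,q}(f)<+\infty\}$, where $$\rho_{p,q}(f)=\left(\frac{1}{2\pi}\int_0^{2\pi}\left(\int_0^1|f(re^{it})|^p\,dr\right)^{q/p}dt\right)^{1/q}\quad\text{if } p<+\infty,$$ $$\rho_{\infty,q}(f)=\left(\frac{1}{2\pi}\int_0^{2\pi}\left(\sup_{r\in[0,1)}|f(re^{it})|\right)^{q}dt\right)^{1/q}.$$ For $1\le p\le +\infty$, $1\le q<+\infty$ the space $RM(p,q)$ is a Banach space with the norm $\rho_{p,q}$; density and separability refer to this norm. *)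

theory Defs
  imports "HOL-Analysis.Analysis" "HOL-Computational_Algebra.Polynomial"
begin

abbreviation unit_disc :: "complex set"  (\<open>\<bbbD>\<close>)
  where "\<bbbD> \<equiv> ball 0 1"

text \<open>Power of an extended nonnegative real; only used for exponents \<open>a > 0\<close>,
  where \<open>0\<close> is mapped to \<open>0\<close> and \<open>\<infinity>\<close> to \<open>\<infinity>\<close>.\<close>

definition enn_powr :: "ennreal \<Rightarrow> real \<Rightarrow> ennreal"
  where "enn_powr x a = (if x = \<infinity> then \<infinity> else ennreal (enn2real x powr a))"

text \<open>All integrals and suprema are taken in \<open>[0, \<infinity>]\<close>, so that \<open>\<rho>\<^bsub>p,q\<^esub>(f)\<close> is defined
  (possibly infinite) for every \<open>f\<close>. The radial integral runs over \<open>[0, 1)\<close>, hence only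
  values of \<open>f\<close> in the disc matter.\<close>

definition rho :: "ennreal \<Rightarrow> real \<Rightarrow> (complex \<Rightarrow> complex) \<Rightarrow> ennreal"
  where "rho p q f =
    enn_powr (ennreal (1 / (2 * pi)) *
      (\<integral>\<^sup>+ t \<in> {0..2 * pi}.
        (if p = \<infinity>
         then enn_powr (SUP r \<in> {0..<1::real}. ennreal (cmod (f (of_real r * cis t)))) q
         else enn_powr (\<integral>\<^sup>+ r \<in> {0..<1::real}.
                ennreal (cmod (f (of_real r * cis t)) powr enn2real p) \<partial>lborel)
              (q / enn2real p)) \<partial>lborel))
    (1 / q)"

text \<open>Functions on the disc are represented by functions on \<open>\<complex>\<close> that are \<open>undefined\<close> outside
  the disc, so that HOL equality is equality on the disc and \<open>\<rho>\<^bsub>p,q\<^esub>\<close> separates points.\<close>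

definition RM :: "ennreal \<Rightarrow> real \<Rightarrow> (complex \<Rightarrow> complex) set"
  where "RM p q = {f \<in> extensional \<bbbD>. f holomorphic_on \<bbbD> \<and> rho p q f < \<infinity>}"

definition RM_dist :: "ennreal \<Rightarrow> real \<Rightarrow> (complex \<Rightarrow> complex) \<Rightarrow> (complex \<Rightarrow> complex) \<Rightarrow> real"
  where "RM_dist p q f g = enn2real (rho p q (\<lambda>z. f z - g z))"

definition RM_topology :: "ennreal \<Rightarrow> real \<Rightarrow> (complex \<Rightarrow> complex) topology"
  where "RM_topology p q = Metric_space.mtopology (RM p q) (RM_dist p q)"

definition disc_polynomials :: "(complex \<Rightarrow> complex) set"
  where "disc_polynomials = range (\<lambda>P :: complex poly. restrict (poly P) \<bbbD>)"

end

theory Submission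
  imports Defs "HOL-Complex_Analysis.Complex_Analysis"
begin

text \<open>The dilates \<open>f\<^sub>s(z) = f(s z)\<close>, \<open>s < 1\<close>, are uniform limits of polynomials on the disc, so it
  suffices to show that \<open>f\<^sub>s\<close> tends to \<open>f\<close> in the norm as \<open>s\<close> tends to 1. The radial norm of
  \<open>f\<^sub>s - f\<close> on each ray is at most three times that of \<open>f\<close> (when \<open>s \<ge> 1/2\<close>), so by dominated
  convergence it is enough that it tends to 0 on almost every ray. For \<open>p < \<infinity>\<close> this is Fatou's
  lemma on a ray; for \<open>p = \<infinity>\<close> it says that \<open>f\<close> has a radial limit at almost every point of the
  circle. The latter follows from the weak type inequality for the radial maximal function of
  functions analytic on the closed disc, once \<open>f\<close> has been approximated in \<open>L\<^sup>1\<close> of the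
  circle; the integrable radial maximal function of \<open>f\<close> makes the approximation possible.\<close>

subsection \<open>The radial maximal function\<close>

text \<open>The case \<open>p = \<infinity>\<close> shapes the proof: a supremum over a ray is not
  controlled by almost everywhere convergence along it, so \<open>f\<close> must be understood up to
  the end of the ray. The radial limit enters as uniform continuity on the half-open ray: this
  property survives uniform limits, and it bounds \<open>f\<close> at s r minus \<open>f\<close> at
  r uniformly in r, because these points are at distance at most 1 - s. No boundary function of
  \<open>f\<close> is constructed. Bounded sequences in L^1 lack weak compactness, so a square mean
  with an integrable weight is minimised instead; its minimising sequence is Cauchy in L^1. The weak
  type inequality turns small L^1 distance on the circle into uniform closeness on every ray outside
  a small set, and Borel-Cantelli disposes of these sets. The restriction s >= 1/2 keeps the change
  of variables factor at most 2, and adding \<open>f\<close> itself gives the factor three. For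
  separability the coefficients are drawn from a countable dense set, so that one approximation
  serves both claims.\<close>

lemma has_integral_shift_real:
  fixes g :: "real \<Rightarrow> 'b::euclidean_space"
  assumes "(g has_integral I) {c + a..c + b}"
  shows "((\<lambda>x. g (c + x)) has_integral I) {a..b}"
  using has_integral_affinity'[of g I "c + a" "c + b" 1 c] assms
  by (simp add: add.commute)

lemma has_integral_reflect_shift_real:
  fixes g :: "real \<Rightarrow> 'b::euclidean_space"
  assumes "(g has_integral I) {c - b..c - a}"
  shows "((\<lambda>x. g (c - x)) has_integral I) {a..b}"
proof -
  have "((\<lambda>x. g (c + x)) has_integral I) {-b..-a}"
    using assms by (intro has_integral_shift_real) simp
  from has_integral_reflect_real[THEN iffD2, OF this] show ?thesis
    by simp
qed

lemma integral_sym_interval: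
  fixes u :: "real \<Rightarrow> real"
  assumes "continuous_on UNIV u" "0 \<le> d"
  shows "integral {0..d} (\<lambda>t. u (x + t) + u (x - t)) = integral {x - d..x + d} u"
proof -
  have i: "(u has_integral integral {a..b} u) {a..b}" for a b
    using assms continuous_on_subset
    by (blast intro: integrable_integral integrable_continuous_real)
  have "((\<lambda>t. u (x + t)) has_integral integral {x..x + d} u) {0..d}"
    by (rule has_integral_shift_real) (use i in simp)
  moreover have "((\<lambda>t. u (x - t)) has_integral integral {x - d..x} u) {0..d}"
    by (rule has_integral_reflect_shift_real) (use i in simp)
  ultimately have "((\<lambda>t. u (x + t) + u (x - t)) has_integral
      integral {x..x + d} u + integral {x - d..x} u) {0..d}"
    by (rule has_integral_add)
  moreover have "integral {x - d..x} u + integral {x..x + d} u = integral {x - d..x + d} u"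
    using assms by (intro Henstock_Kurzweil_Integration.integral_combine
        integrable_continuous_real) (auto intro: continuous_on_subset)
  ultimately show ?thesis by (simp add: integral_unique)
qed

text \<open>Folding the period onto [0, pi] matters because the Poisson kernel decreases
  there.\<close>

lemma integral_periodic_sym:
  fixes u :: "real \<Rightarrow> real"
  assumes u: "continuous_on UNIV u" and per: "\<And>t. u (t + 2 * pi) = u t"
  shows "integral {0..2 * pi} u = integral {0..pi} (\<lambda>t. u t + u (- t))"
proof -
  have i: "(u has_integral integral {a..b} u) {a..b}" for a b
    using u continuous_on_subset
    by (blast intro: integrable_integral integrable_continuous_real)
  have "((\<lambda>t. u (2 * pi - t)) has_integral integral {pi..2 * pi} u) {0..pi}"
    by (rule has_integral_reflect_shift_real) (use i in simp)
  moreover have "u (2 * pi - t) = u (- t)" for t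
    using per[of "- t"] by (simp add: algebra_simps)
  ultimately have "((\<lambda>t. u t + u (- t)) has_integral
      integral {0..pi} u + integral {pi..2 * pi} u) {0..pi}"
    using i by (intro has_integral_add) simp_all
  moreover have "integral {0..pi} u + integral {pi..2 * pi} u = integral {0..2 * pi} u"
    using u by (intro Henstock_Kurzweil_Integration.integral_combine
        integrable_continuous_real) (auto intro: continuous_on_subset)
  ultimately show ?thesis by (simp add: integral_unique)
qed

text \<open>Arcs centred in [0, 2 pi] of half-length at most pi stay inside [-pi, 3 pi], which
  covers the circle twice.\<close>

lemma integral_periodic_double:
  fixes u :: "real \<Rightarrow> real"
  assumes u: "continuous_on UNIV u" and per: "\<And>t. u (t + 2 * pi) = u t"
  shows "integral {-pi..3 * pi} u = 2 * integral {0..2 * pi} u"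
proof -
  have i: "(u has_integral integral {a..b} u) {a..b}" for a b
    using u continuous_on_subset
    by (blast intro: integrable_integral integrable_continuous_real)
  have per': "u (2 * pi + t) = u t" for t
    using per[of t] by (simp add: add.commute)
  have sh: "integral {2 * pi + a..2 * pi + b} u = integral {a..b} u" for a b
  proof -
    have "((\<lambda>t. u (2 * pi + t)) has_integral integral {2 * pi + a..2 * pi + b} u) {a..b}"
      by (rule has_integral_shift_real) (use i in simp)
    then show ?thesis
      by (simp add: per' integral_unique)
  qed
  have comb: "integral {a..b} u + integral {b..c} u = integral {a..c} u" if "a \<le> b" "b \<le> c" for a b c
    using u that by (intro Henstock_Kurzweil_Integration.integral_combine
        integrable_continuous_real) (auto intro: continuous_on_subset)
  have 1: "integral {pi..2 * pi} u = integral {-pi..0} u" using sh[of "-pi" 0] by simp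
  have 2: "integral {2 * pi..3 * pi} u = integral {0..pi} u" using sh[of 0 pi] by simp
  show ?thesis
    using comb[of "-pi" 0 "3 * pi"] comb[of 0 "2 * pi" "3 * pi"] comb[of 0 pi "2 * pi"] 1 2 pi_gt_zero
    by simp
qed

section \<open>The Poisson kernel and the bound for radial values\<close>

definition poisson :: "real \<Rightarrow> real \<Rightarrow> real"
  where "poisson r t = (1 - r\<^sup>2) / (1 - 2 * r * cos t + r\<^sup>2)"

lemma poisson_denominator_pos:
  fixes r t :: real
  assumes "0 \<le> r" "r < 1"
  shows "0 < 1 - 2 * r * cos t + r\<^sup>2"
proof -
  have "0 < (1 - r)\<^sup>2" using assms by (intro zero_less_power) simp
  also have "\<dots> = 1 - 2 * r * 1 + r\<^sup>2" by (simp add: power2_diff)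
  also have "\<dots> \<le> 1 - 2 * r * cos t + r\<^sup>2"
    using assms mult_left_mono[of "cos t" 1 "2 * r"] by simp
  finally show ?thesis .
qed

lemma poisson_nonneg: "0 \<le> r \<Longrightarrow> r < 1 \<Longrightarrow> 0 \<le> poisson r t"
  using poisson_denominator_pos[of r t] by (simp add: poisson_def abs_square_le_1 power_le_one)

lemma poisson_antimono:
  assumes "0 \<le> r" "r < 1" "0 \<le> s" "s \<le> t" "t \<le> pi"
  shows "poisson r t \<le> poisson r s"
proof -
  have "cos t \<le> cos s" using assms by (simp add: cos_monotone_0_pi_le)
  then have "1 - 2 * r * cos s + r\<^sup>2 \<le> 1 - 2 * r * cos t + r\<^sup>2"
    using assms by (simp add: mult_left_mono)
  then show ?thesis
    unfolding poisson_def using assms poisson_denominator_pos[of r s]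
    by (intro divide_left_mono) (auto simp: power_le_one poisson_denominator_pos)
qed

lemma continuous_on_poisson: "0 \<le> r \<Longrightarrow> r < 1 \<Longrightarrow> continuous_on A (poisson r)"
  unfolding poisson_def
  by (intro continuous_intros ballI) (metis poisson_denominator_pos less_irrefl)

text \<open>Cauchy's formula at the point r is applied to \<open>k\<close>, which agrees with
  \<open>H\<close> at r. On the unit circle w / ((1 - r w)(w - r)) equals 1 / |1 - r w|^2, the
  reciprocal of the denominator of the kernel; the extra factor in \<open>k\<close> thus turns the
  Cauchy kernel into the Poisson kernel.\<close>

lemma poisson_formula:
  fixes h :: "complex \<Rightarrow> complex"
  assumes h: "h holomorphic_on cball 0 1" and r: "0 \<le> r" "r < 1"
  shows "((\<lambda>t. h (cis (\<theta> + t)) * of_real (poisson r t)) has_integral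
           (2 * pi) * h (of_real r * cis \<theta>)) {0..2 * pi}"
proof -
  define H where "H = (\<lambda>w. h (cis \<theta> * w))"
  define k where "k = (\<lambda>w. H w * (1 - (of_real r)\<^sup>2) / (1 - of_real r * w))"
  have nz: "1 - of_real r * w \<noteq> 0" if "cmod w \<le> 1" for w
  proof
    assume "1 - of_real r * w = 0"
    then have "1 = cmod (of_real r * w)" by simp
    also have "\<dots> \<le> r * 1" using r that by (simp add: norm_mult mult_left_le)
    finally show False using r by simp
  qed
  have H: "H holomorphic_on cball 0 1"
    unfolding H_def
    by (rule holomorphic_on_compose_gen[OF _ h, unfolded o_def])
       (auto intro!: holomorphic_intros simp: norm_mult)
  have "k holomorphic_on cball 0 1"
    unfolding k_def by (intro holomorphic_intros H) (use nz in simp)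
  then have "((\<lambda>u. k u / (u - of_real r)) has_contour_integral (2 * of_real pi * \<i> * k (of_real r)))
         (circlepath 0 1)"
    by (rule Cauchy_integral_circlepath_simple) (use r in simp)
  then have "((\<lambda>t. k (cis t) / (cis t - of_real r) * \<i> * cis t)
      has_integral (2 * of_real pi * \<i> * k (of_real r))) {0..2 * pi}"
    unfolding circlepath_def by (subst (asm) has_contour_integral_part_circlepath_iff) auto
  from has_integral_mult_right[OF this, of "- \<i>"]
  have *: "((\<lambda>t. k (cis t) / (cis t - of_real r) * cis t)
      has_integral (2 * of_real pi * k (of_real r))) {0..2 * pi}"
    by (simp add: mult.assoc[symmetric]) (simp add: algebra_simps)
  have "1 - r\<^sup>2 > 0" using r by (simp add: power_less_one_iff abs_square_less_1)
  then have "complex_of_real (1 - r * r) \<noteq> 0" unfolding of_real_eq_0_iff power2_eq_square by simp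
  then have kr: "k (of_real r) = h (of_real r * cis \<theta>)"
    unfolding k_def H_def by (simp add: power2_eq_square mult.commute)
  have "k (cis t) / (cis t - of_real r) * cis t = h (cis (\<theta> + t)) * of_real (poisson r t)" for t
  proof -
    have nz1: "cis t - of_real r \<noteq> 0"
    proof
      assume "cis t - of_real r = 0"
      then have "cmod (cis t) = cmod (of_real r)" by simp
      then show False using r by simp
    qed
    have "(1 - of_real r * cis t) * (cis t - of_real r) = cis t * of_real (1 - 2 * r * cos t + r\<^sup>2)"
    proof -
      show ?thesis
        by (simp add: complex_eq_iff power2_eq_square algebra_simps)
           (metis distrib_left mult.right_neutral sin_cos_squared_add3)
    qed
    moreover have "complex_of_real (1 - 2 * r * cos t + r\<^sup>2) \<noteq> 0"
      unfolding of_real_eq_0_iff using poisson_denominator_pos[OF r, of t] by simp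
    ultimately have "cis t / ((1 - of_real r * cis t) * (cis t - of_real r)) = 1 / of_real (1 - 2 * r * cos t + r\<^sup>2)"
      by (simp only: mult_divide_mult_cancel_left[of "cis t" 1, simplified] ) simp
    then have "k (cis t) / (cis t - of_real r) * cis t
      = H (cis t) * (1 - (of_real r)\<^sup>2) * (1 / of_real (1 - 2 * r * cos t + r\<^sup>2))"
      unfolding k_def by (metis (no_types, lifting) divide_divide_eq_left times_divide_eq_left times_divide_eq_right)
    also have "\<dots> = h (cis (\<theta> + t)) * of_real (poisson r t)"
      by (simp add: H_def poisson_def cis_mult)
    finally show ?thesis .
  qed
  with * kr show ?thesis by simp
qed

lemma continuous_on_circle_shift:
  assumes h: "continuous_on (cball 0 1) h"
  shows "continuous_on A (\<lambda>t. h (cis (\<theta> + t)))"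
  by (rule continuous_on_compose2[OF h]) (auto intro!: continuous_intros)

lemma integral_poisson:
  assumes "0 \<le> r" "r < 1"
  shows "integral {0..pi} (poisson r) = pi"
proof -
  have "((\<lambda>t. complex_of_real (poisson r t)) has_integral complex_of_real (2 * pi)) {0..2 * pi}"
    using poisson_formula[of "\<lambda>_. 1" r 0] assms by simp
  from has_integral_linear[OF this bounded_linear_Re]
  have "integral {0..2 * pi} (poisson r) = 2 * pi"
    by (simp add: o_def integral_unique)
  moreover have "integral {0..2 * pi} (poisson r) = integral {0..pi} (\<lambda>t. poisson r t + poisson r (- t))"
    by (rule integral_periodic_sym) (use assms continuous_on_poisson in \<open>auto simp: poisson_def\<close>)
  moreover have "poisson r (- t) = poisson r t" for t by (simp add: poisson_def)
  ultimately show ?thesis by (simp flip: mult_2)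
qed

text \<open>The kernel decreases on \<open>[0, \<pi>]\<close>, so the second mean value theorem reduces the Poisson
  integral to averages of \<open>|h|\<close> over symmetric arcs, without differentiating the kernel.\<close>

lemma radial_le_of_averages_le:
  fixes h :: "complex \<Rightarrow> complex"
  assumes h: "h holomorphic_on cball 0 1" and r: "0 \<le> r" "r < 1"
    and avg: "\<And>d. 0 \<le> d \<Longrightarrow> d \<le> pi \<Longrightarrow>
       integral {\<theta> - d..\<theta> + d} (\<lambda>t. cmod (h (cis t))) \<le> 2 * d * K"
  shows "cmod (h (of_real r * cis \<theta>)) \<le> K"
proof -
  define u where "u = (\<lambda>t. cmod (h (cis t)))"
  define v where "v = (\<lambda>t. u (\<theta> + t) + u (\<theta> - t))"
  have hc: "continuous_on (cball 0 1) h" using h holomorphic_on_imp_continuous_on by blast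
  have cu: "continuous_on UNIV u"
    unfolding u_def using continuous_on_circle_shift[OF hc, of UNIV 0] by (intro continuous_intros) simp
  have cv: "continuous_on A v" for A
    unfolding v_def
    by (intro continuous_intros continuous_on_compose2[OF cu]) auto
  have cup: "continuous_on UNIV (\<lambda>t. u (\<theta> + t) * poisson r t)"
    using r by (intro continuous_intros continuous_on_poisson continuous_on_compose2[OF cu]) auto
  have "2 * pi * cmod (h (of_real r * cis \<theta>))
      = cmod (integral {0..2 * pi} (\<lambda>t. h (cis (\<theta> + t)) * of_real (poisson r t)))"
    using integral_unique[OF poisson_formula[OF h r, of \<theta>]] by (simp add: norm_mult)
  also have "\<dots> \<le> integral {0..2 * pi} (\<lambda>t. u (\<theta> + t) * poisson r t)"
  proof (rule integral_norm_bound_integral)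
    show "(\<lambda>t. h (cis (\<theta> + t)) * of_real (poisson r t)) integrable_on {0..2 * pi}"
      using poisson_formula[OF h r, of \<theta>] by (rule has_integral_integrable)
    show "(\<lambda>t. u (\<theta> + t) * poisson r t) integrable_on {0..2 * pi}"
      by (rule integrable_continuous_real) (rule continuous_on_subset[OF cup], simp)
  qed (use poisson_nonneg[OF r] in \<open>simp add: u_def norm_mult\<close>)
  also have "\<dots> = integral {0..pi} (\<lambda>t. poisson r t * v t)"
  proof (subst integral_periodic_sym[OF cup])
    show "u (\<theta> + (t + 2 * pi)) * poisson r (t + 2 * pi) = u (\<theta> + t) * poisson r t" for t
      by (simp add: u_def poisson_def flip: add.assoc cis_mult)
  qed (simp add: v_def poisson_def algebra_simps add_divide_distrib diff_divide_distrib)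
  also have "\<dots> \<le> 2 * K * pi"
  proof -
    \<comment> \<open>By hypothesis \<open>D\<close> has nonnegative integral over every initial
      interval of [0, pi], although it may change sign.\<close>
    define D where "D = (\<lambda>t. 2 * K - v t)"
    have iD: "D integrable_on {a..b}" for a b
      unfolding D_def by (intro integrable_continuous_real continuous_intros cv)
    have Dint: "integral {0..d} D = 2 * d * K - integral {\<theta> - d..\<theta> + d} u" if "0 \<le> d" for d
      unfolding D_def using that integral_sym_interval[OF cu that, of \<theta>]
      by (subst Henstock_Kurzweil_Integration.integral_diff)
         (auto intro!: integrable_continuous_real cv simp: v_def[symmetric])
    have Dnn: "0 \<le> integral {0..d} D" if "0 \<le> d" "d \<le> pi" for d
      using avg[OF that] Dint[OF that(1)] by (simp add: u_def)
    \<comment> \<open>The mean value theorem asks for an increasing weight, hence the minus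
      sign.\<close>
    obtain c where c: "c \<in> {0..pi}" and
      ceq: "integral {0..pi} (\<lambda>t. - poisson r t * D t) =
         - poisson r 0 * integral {0..c} D + - poisson r pi * integral {c..pi} D"
      by (rule second_mean_value_theorem[of D 0 pi "\<lambda>t. - poisson r t"])
         (use r poisson_antimono iD in auto)
    have "integral {0..c} D + integral {c..pi} D = integral {0..pi} D"
      using c iD by (intro Henstock_Kurzweil_Integration.integral_combine) auto
    \<comment> \<open>After regrouping, each product consists of a nonnegative kernel factor and an
      integral of \<open>D\<close> over an initial interval.\<close>
    then have "integral {0..pi} (\<lambda>t. - poisson r t * D t) =
       - (poisson r 0 - poisson r pi) * integral {0..c} D - poisson r pi * integral {0..pi} D"
      unfolding ceq by (auto simp: algebra_simps simp flip: distrib_left)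
    also have "\<dots> \<le> 0"
    proof -
      have "0 \<le> (poisson r 0 - poisson r pi) * integral {0..c} D"
        using c Dnn poisson_antimono[OF r, of 0 pi] by simp
      moreover have "0 \<le> poisson r pi * integral {0..pi} D"
        using Dnn poisson_nonneg[OF r] by simp
      ultimately show ?thesis unfolding mult_minus_left by linarith
    qed
    finally have "integral {0..pi} (\<lambda>t. poisson r t * v t - 2 * K * poisson r t) \<le> 0"
      by (simp add: D_def algebra_simps)
    moreover have "integral {0..pi} (\<lambda>t. poisson r t * v t - 2 * K * poisson r t)
       = integral {0..pi} (\<lambda>t. poisson r t * v t) - 2 * K * pi"
      using r by (subst Henstock_Kurzweil_Integration.integral_diff)
         (auto intro!: integrable_continuous_real continuous_intros cv continuous_on_poisson simp: integral_poisson)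
    ultimately show ?thesis by simp
  qed
  finally show ?thesis by simp
qed

section \<open>The weak type inequality by Vitali covering\<close>

lemma nn_integral_continuous_interval:
  fixes u :: "real \<Rightarrow> real"
  assumes u: "continuous_on {a..b} u" and "\<And>t. t \<in> {a..b} \<Longrightarrow> 0 \<le> u t"
  shows "(\<integral>\<^sup>+t\<in>{a..b}. ennreal (u t) \<partial>lborel) = ennreal (integral {a..b} u)"
  using assms by (intro nn_integral_has_integral_lebesgue' integrable_integral integrable_continuous_real)

text \<open>Among the arcs on which the mean of \<open>u\<close> exceeds \<open>K\<close>, Vitali's
  lemma selects a countable disjoint family whose fivefold enlargements cover all bad centres.
  Disjointness bounds the total length by the integral of \<open>u\<close> over the whole range.
  \<open>V\<close> is the union of the enlarged arcs, a Borel superset of the bad set.\<close>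

lemma maximal_averages_weak_type:
  fixes u :: "real \<Rightarrow> real"
  assumes u: "continuous_on UNIV u" and nn: "\<And>t. 0 \<le> u t" and K: "0 < K"
  obtains V where "V \<in> sets lborel"
    "\<And>\<theta> d. \<theta> \<in> {0..2 * pi} \<Longrightarrow> 0 \<le> d \<Longrightarrow> d \<le> pi \<Longrightarrow>
       2 * d * K < integral {\<theta> - d..\<theta> + d} u \<Longrightarrow> \<theta> \<in> V"
    "emeasure lborel V \<le> ennreal (5 / K * integral {-pi..3 * pi} u)"
proof -
  define P where "P \<theta> d \<longleftrightarrow> 0 < d \<and> d \<le> pi \<and> 2 * d * K < integral {\<theta> - d..\<theta> + d} u" for \<theta> d
  define S where "S = {\<theta> \<in> {0..2 * pi}. \<exists>d. P \<theta> d}"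
  define d where "d \<theta> = (SOME d. P \<theta> d)" for \<theta>
  have d: "P \<theta> (d \<theta>)" if "\<theta> \<in> S" for \<theta>
    using that unfolding S_def d_def by (auto intro: someI_ex)
  have cov: "S \<subseteq> (\<Union>\<theta>\<in>S. cball \<theta> (d \<theta>))"
    using d by (force simp: P_def)
  have rad: "0 < d \<theta> \<and> d \<theta> \<le> pi" if "\<theta> \<in> S" for \<theta>
    using d[OF that] by (simp add: P_def)
  obtain C where C: "countable C" "C \<subseteq> S"
     "pairwise (\<lambda>i j. disjnt (cball i (d i)) (cball j (d j))) C"
     "S \<subseteq> (\<Union>i\<in>C. cball i (5 * d i))"
    using Vitali_covering_lemma_cballs[OF cov rad] by blast
  define V where "V = (\<Union>i\<in>C. cball i (5 * d i))"
  \<comment> \<open>Integrals of \<open>u\<close> over disjoint arcs add up by countable additivity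
    of this measure.\<close>
  define \<nu> where "\<nu> = density lborel (\<lambda>t. ennreal (u t))"
  have [measurable]: "u \<in> borel_measurable borel" "V \<in> sets borel"
    using u C(1) by (auto intro!: borel_measurable_continuous_onI sets.countable_UN'' simp: V_def)
  have \<nu>: "emeasure \<nu> {a..b} = ennreal (integral {a..b} u)" for a b
    using nn continuous_on_subset[OF u, of "{a..b}"]
    by (subst nn_integral_continuous_interval[symmetric]) (auto simp: \<nu>_def emeasure_density)
  have ball: "emeasure lborel (cball i (5 * d i)) \<le> ennreal (5 / K) * emeasure \<nu> (cball i (d i))"
    if "i \<in> C" for i
  proof -
    have "P i (d i)" using that C(2) d by blast
    then have "10 * d i \<le> 5 / K * integral {i - d i..i + d i} u" and "0 < d i"
      using K by (auto simp: P_def field_simps)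
    moreover have "0 \<le> integral {i - d i..i + d i} u"
      using nn u by (intro integral_nonneg integrable_continuous_real) (auto intro: continuous_on_subset)
    ultimately show ?thesis
      using K by (simp add: cball_eq_atLeastAtMost \<nu> flip: ennreal_mult)
  qed
  have "emeasure lborel V = (\<integral>\<^sup>+x. indicator V x \<partial>lborel)" by simp
  \<comment> \<open>The countable sum over \<open>C\<close> is an integral over counting measure, so
    that it can be exchanged with the Lebesgue integral.\<close>
  also have "\<dots> \<le> (\<integral>\<^sup>+x. (\<integral>\<^sup>+i. indicator (cball i (5 * d i)) x \<partial>count_space C) \<partial>lborel)"
  proof (rule nn_integral_mono)
    fix x
    show "indicator V x \<le> (\<integral>\<^sup>+i. indicator (cball i (5 * d i)) x \<partial>count_space C)"
    proof (cases "x \<in> V")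
      case True
      then obtain i where i: "i \<in> C" "x \<in> cball i (5 * d i)" unfolding V_def by blast
      have "1 = (indicator (cball i (5 * d i)) x :: ennreal)" using i by simp
      also have "\<dots> \<le> (\<integral>\<^sup>+i. indicator (cball i (5 * d i)) x \<partial>count_space C)"
        by (rule nn_integral_ge_point[OF i(1)])
      finally show ?thesis using True by simp
    qed simp
  qed
  also have "\<dots> = (\<integral>\<^sup>+i. (\<integral>\<^sup>+x. indicator (cball i (5 * d i)) x \<partial>lborel) \<partial>count_space C)"
    using C(1) by (intro nn_integral_count_space_nn_integral borel_measurable_indicator) auto
  also have "\<dots> = (\<integral>\<^sup>+i. emeasure lborel (cball i (5 * d i)) \<partial>count_space C)"
    by simp
  also have "\<dots> \<le> (\<integral>\<^sup>+i. ennreal (5 / K) * emeasure \<nu> (cball i (d i)) \<partial>count_space C)"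
    using ball by (intro nn_integral_mono) simp
  also have "\<dots> = ennreal (5 / K) * emeasure \<nu> (\<Union>i\<in>C. cball i (d i))"
    using C by (subst emeasure_UN_countable)
      (auto simp: \<nu>_def nn_integral_cmult disjoint_family_on_def pairwise_def disjnt_def)
  also have "\<dots> \<le> ennreal (5 / K) * emeasure \<nu> {-pi..3 * pi}"
  proof (intro mult_left_mono emeasure_mono)
    show "(\<Union>i\<in>C. cball i (d i)) \<subseteq> {-pi..3 * pi}"
      using C(2) rad by (force simp: S_def cball_eq_atLeastAtMost)
  qed (simp_all add: \<nu>_def)
  finally have "emeasure lborel V \<le> ennreal (5 / K * integral {-pi..3 * pi} u)"
    using K nn u by (subst ennreal_mult)
      (auto simp: \<nu> intro!: integral_nonneg integrable_continuous_real intro: continuous_on_subset)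
  moreover have "\<theta> \<in> V" if "\<theta> \<in> {0..2 * pi}" "0 \<le> e" "e \<le> pi"
    "2 * e * K < integral {\<theta> - e..\<theta> + e} u" for \<theta> e
  proof -
    have "0 < e" using that by (cases "e = 0") auto
    then have "\<theta> \<in> S" using that by (auto simp: S_def P_def)
    then show ?thesis using C(4) unfolding V_def by blast
  qed
  ultimately show ?thesis by (intro that[of V]) auto
qed

text \<open>Outside \<open>V\<close> every symmetric arc mean of |h| is at most \<open>K\<close>,
  and the Poisson bound carries this over to the whole ray. The constant 10 is five from Vitali
  times two from the doubled period.\<close>

lemma radial_weak_type:
  assumes h: "h holomorphic_on cball 0 1" and K: "0 < K"
  obtains V where "V \<in> sets lborel"
    "\<And>\<theta> r. \<theta> \<in> {0..2 * pi} \<Longrightarrow> \<theta> \<notin> V \<Longrightarrow> 0 \<le> r \<Longrightarrow> r < 1 \<Longrightarrow> cmod (h (of_real r * cis \<theta>)) \<le> K"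
    "emeasure lborel V \<le> ennreal (10 / K * integral {0..2 * pi} (\<lambda>t. cmod (h (cis t))))"
proof -
  have u: "continuous_on UNIV (\<lambda>t. cmod (h (cis t)))"
    using continuous_on_circle_shift[OF holomorphic_on_imp_continuous_on[OF h], of UNIV 0]
    by (intro continuous_intros) simp
  obtain V where V: "V \<in> sets lborel"
    "\<And>\<theta> d. \<theta> \<in> {0..2 * pi} \<Longrightarrow> 0 \<le> d \<Longrightarrow> d \<le> pi \<Longrightarrow>
       2 * d * K < integral {\<theta> - d..\<theta> + d} (\<lambda>t. cmod (h (cis t))) \<Longrightarrow> \<theta> \<in> V"
    "emeasure lborel V \<le> ennreal (5 / K * integral {-pi..3 * pi} (\<lambda>t. cmod (h (cis t))))"
    using maximal_averages_weak_type[OF u _ K] by auto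
  show ?thesis
  proof
    show "cmod (h (of_real r * cis \<theta>)) \<le> K"
      if "\<theta> \<in> {0..2 * pi}" "\<theta> \<notin> V" "0 \<le> r" "r < 1" for \<theta> r
      by (rule radial_le_of_averages_le[OF h]) (use that V(2) in \<open>force simp: not_less[symmetric]\<close>)+
    have "integral {-pi..3 * pi} (\<lambda>t. cmod (h (cis t))) = 2 * integral {0..2 * pi} (\<lambda>t. cmod (h (cis t)))"
      by (rule integral_periodic_double[OF u]) (simp flip: cis_mult)
    with V(3) show "emeasure lborel V \<le> ennreal (10 / K * integral {0..2 * pi} (\<lambda>t. cmod (h (cis t))))"
      by simp
  qed (fact V(1))
qed

subsection \<open>Radial limits\<close>

lemma uniformly_continuous_on_uniform_limit:
  fixes g :: "nat \<Rightarrow> 'a::metric_space \<Rightarrow> 'b::metric_space"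
  assumes g: "\<forall>\<^sub>F n in sequentially. uniformly_continuous_on S (g n)"
    and lim: "uniform_limit S g f sequentially"
  shows "uniformly_continuous_on S f"
  unfolding uniformly_continuous_on_def
proof (intro allI impI)
  fix e :: real assume "e > 0"
  then have "\<forall>\<^sub>F n in sequentially. \<forall>x\<in>S. dist (g n x) (f x) < e / 3"
    using uniform_limitD[OF lim, of "e / 3"] by simp
  with g have "\<forall>\<^sub>F n in sequentially. uniformly_continuous_on S (g n) \<and> (\<forall>x\<in>S. dist (g n x) (f x) < e / 3)"
    by (rule eventually_conj)
  then obtain n where uc: "uniformly_continuous_on S (g n)" and n: "\<And>x. x \<in> S \<Longrightarrow> dist (g n x) (f x) < e / 3"
    using eventually_happens'[OF sequentially_bot] by blast
  obtain d where d: "d > 0" "\<And>x x'. x \<in> S \<Longrightarrow> x' \<in> S \<Longrightarrow> dist x' x < d \<Longrightarrow> dist (g n x') (g n x) < e / 3"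
    using uc \<open>e > 0\<close> unfolding uniformly_continuous_on_def
    by (metis divide_pos_pos zero_less_numeral)
  have "dist (f x') (f x) < e" if "x \<in> S" "x' \<in> S" "dist x' x < d" for x x'
    using n[OF that(1)] n[OF that(2)] d(2)[OF that]
      dist_triangle[of "f x'" "f x" "g n x'"] dist_triangle[of "g n x'" "f x" "g n x"]
    by (simp add: dist_commute)
  with d(1) show "\<exists>d>0. \<forall>x\<in>S. \<forall>x'\<in>S. dist x' x < d \<longrightarrow> dist (f x') (f x) < e"
    by blast
qed

lemma uniformly_continuous_on_ray:
  assumes "g analytic_on cball 0 1"
  shows "uniformly_continuous_on {0..<1} (\<lambda>r. g (of_real r * cis t))"
proof -
  have "continuous_on (cball 0 1) g"
    using assms analytic_imp_holomorphic holomorphic_on_imp_continuous_on by blast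
  then have "continuous_on {0..1} (\<lambda>r. g (of_real r * cis t))"
    by (rule continuous_on_compose2) (auto intro!: continuous_intros simp: norm_mult)
  then have "uniformly_continuous_on {0..1} (\<lambda>r. g (of_real r * cis t))"
    by (rule compact_uniformly_continuous) simp
  then show ?thesis
    unfolding uniformly_continuous_on_def by (meson atLeastAtMost_iff atLeastLessThan_iff less_imp_le)
qed

section \<open>Dilates and auxiliary inequalities for the L^1 approximation\<close>

lemma analytic_on_dilate:
  assumes f: "f holomorphic_on ball 0 1" and "0 \<le> s" "s < 1"
  shows "(\<lambda>z. f (of_real s * z)) analytic_on cball 0 1"
proof -
  have "of_real s * z \<in> ball 0 1" if "z \<in> cball 0 1" for z :: complex
  proof -
    have "cmod (of_real s * z) \<le> s * 1"
      unfolding norm_mult using that assms by (intro mult_mono) auto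
    with assms show ?thesis by simp
  qed
  moreover have "f analytic_on ball 0 1" using f by (simp add: analytic_on_open)
  ultimately have "f \<circ> (\<lambda>z. of_real s * z) analytic_on cball 0 1"
    by (intro analytic_on_compose_gen[of _ _ _ "ball 0 1"]) auto
  then show ?thesis by (simp add: o_def)
qed

lemma dilate_close:
  assumes f: "f holomorphic_on ball 0 1" and c: "0 \<le> c" "c < 1" and e: "0 < e"
  obtains s where "0 \<le> s" "s < 1" "\<And>z. cmod z \<le> c \<Longrightarrow> cmod (f (of_real s * z) - f z) \<le> e"
proof -
  have "continuous_on (cball 0 c) f"
    using f c by (intro holomorphic_on_imp_continuous_on) (auto elim!: holomorphic_on_subset)
  then have "uniformly_continuous_on (cball 0 c) f"
    by (rule compact_uniformly_continuous) simp
  then obtain d where d: "d > 0"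
    "\<And>z z'. z \<in> cball 0 c \<Longrightarrow> z' \<in> cball 0 c \<Longrightarrow> dist z' z < d \<Longrightarrow> dist (f z') (f z) < e"
    using e unfolding uniformly_continuous_on_def by metis
  \<comment> \<open>This makes 1 - s at most \<open>d / 2\<close>; the maximum with 0 handles
    \<open>d > 2\<close>.\<close>
  define s where "s = max 0 (1 - d / 2)"
  have s: "0 \<le> s" "s < 1" "1 - s < d" using d(1) by (auto simp: s_def)
  have "cmod (f (of_real s * z) - f z) \<le> e" if z: "cmod z \<le> c" for z
  proof -
    have "cmod (of_real s * z) \<le> 1 * cmod z"
      unfolding norm_mult using s by (intro mult_right_mono) auto
    then have 1: "of_real s * z \<in> cball 0 c" using z by simp
    have "of_real s * z - z = of_real (s - 1) * z" by (simp add: algebra_simps)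
    then have "dist (of_real s * z) z = \<bar>s - 1\<bar> * cmod z"
      by (simp only: dist_norm norm_mult norm_of_real)
    also have "\<dots> \<le> (1 - s) * 1" using s z c by (intro mult_mono) auto
    finally have "dist (of_real s * z) z < d" using s by simp
    from d(2)[OF _ 1 this] z show ?thesis by (simp add: dist_norm)
  qed
  with s show ?thesis using that by blast
qed

text \<open>The arithmetic-geometric mean inequality. Integrated over the circle it bounds an L^1
  norm by the weighted square mean, in the role of Cauchy-Schwarz with a free parameter
  \<open>e\<close>.\<close>

lemma le_weighted_square:
  fixes x w e :: real
  assumes "0 < w" "0 < e"
  shows "x \<le> e * w + (x\<^sup>2 / w) / e"
proof -
  have "2 * x * (e * w) \<le> x\<^sup>2 + (e * w)\<^sup>2" by (rule sum_squares_bound)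
  moreover have "0 \<le> x\<^sup>2 + (e * w)\<^sup>2" by simp
  ultimately have "x * (e * w) \<le> (e * w) * (e * w) + x\<^sup>2"
    unfolding power2_eq_square[of "e * w"] by linarith
  then have "x \<le> ((e * w) * (e * w) + x\<^sup>2) / (e * w)"
    using assms by (simp add: pos_le_divide_eq)
  also have "\<dots> = e * w + (x\<^sup>2 / w) / e"
    using assms by (simp add: field_simps power2_eq_square)
  finally show ?thesis .
qed

lemma complex_parallelogram:
  "(cmod ((a - b) / 2))\<^sup>2 = (cmod a)\<^sup>2 / 2 + (cmod b)\<^sup>2 / 2 - (cmod ((a + b) / 2))\<^sup>2"
  unfolding norm_divide power_divide cmod_power2 by (simp add: power2_eq_square field_simps)

text \<open>Weighting the circle by the reciprocal of an integrable majorant turns the dilates of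
  \<open>f\<close> into a bounded family in a Hilbert space. Near-minimizers of the norm over the convex sets
  of analytic functions close to \<open>f\<close> on compact subsets are then a Cauchy sequence, by the
  parallelogram law, so that \<open>f\<close> is approximable in \<open>L\<^sup>1\<close> of the circle.\<close>

lemma L1_circle_approximation:
  fixes f :: "complex \<Rightarrow> complex" and F :: "real \<Rightarrow> ennreal"
  assumes f: "f holomorphic_on ball 0 1"
    and F[measurable]: "F \<in> borel_measurable borel"
    and bd: "\<And>r t. 0 \<le> r \<Longrightarrow> r < 1 \<Longrightarrow> ennreal (cmod (f (of_real r * cis t))) \<le> F t"
    and fin: "(\<integral>\<^sup>+t\<in>{0..2 * pi}. F t \<partial>lborel) < \<infinity>"
  obtains g :: "nat \<Rightarrow> complex \<Rightarrow> complex" where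
    "\<And>n. g n analytic_on cball 0 1"
    "\<And>z. z \<in> ball 0 1 \<Longrightarrow> (\<lambda>n. g n z) \<longlonglongrightarrow> f z"
    "\<And>e. 0 < e \<Longrightarrow> \<exists>k. \<forall>n\<ge>k. \<forall>m\<ge>n.
        integral {0..2 * pi} (\<lambda>t. cmod (g n (cis t) - g m (cis t))) \<le> e"
proof -
  define M where "M = restrict_space lborel {0..2 * pi}"
  interpret finite_measure M
    by standard (simp add: M_def space_restrict_space emeasure_restrict_space)
  have meas: "h \<in> borel_measurable M" if "h \<in> borel_measurable borel" for h :: "real \<Rightarrow> 'a::topological_space"
    using that by (simp add: M_def measurable_restrict_space1)
  \<comment> \<open>The weight is at least 1, so dividing by it preserves integrability of bounded
    functions. Where \<open>F\<close> is infinite its value is 1, since \<open>enn2real\<close>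
    sends infinity to 0; this happens only on a null set.\<close>
  define w where "w t = max 1 (enn2real (F t))" for t
  have w[measurable]: "w \<in> borel_measurable borel" unfolding w_def by measurable
  have w1: "1 \<le> w t" for t by (simp add: w_def)
  have w0: "0 < w t" for t using w1[of t] by simp
  have finM: "(\<integral>\<^sup>+t. F t \<partial>M) < \<infinity>"
    using fin by (simp add: M_def nn_integral_restrict_space)
  have AEF: "AE t in M. F t \<noteq> \<infinity>"
    using finM by (intro nn_integral_PInf_AE meas[OF F]) auto
  have wF: "ennreal (w t) \<le> 1 + F t" for t
  proof (cases "F t")
    case (real x)
    then show ?thesis by (simp add: w_def flip: ennreal_1 ennreal_plus)
  qed simp
  have iw: "integrable M w"
  proof (rule integrableI_nonneg)
    have "(\<integral>\<^sup>+t. ennreal (w t) \<partial>M) \<le> (\<integral>\<^sup>+t. 1 + F t \<partial>M)"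
      by (intro nn_integral_mono wF)
    also have "\<dots> = emeasure M (space M) + (\<integral>\<^sup>+t. F t \<partial>M)"
      by (subst nn_integral_add) (simp_all add: meas[OF F])
    also have "\<dots> < \<infinity>" using finM by (simp add: emeasure_eq_measure)
    finally show "(\<integral>\<^sup>+t. ennreal (w t) \<partial>M) < \<infinity>" .
    show "w \<in> borel_measurable M" by (rule meas[OF w])
    show "AE t in M. 0 \<le> w t" using w0 less_imp_le by blast
  qed
  define W where "W = integral\<^sup>L M w"
  \<comment> \<open>The squared norm of a weighted L^2 space. If |h| is at most \<open>w\<close>
    almost everywhere on the circle, then |h|^2 / w is at most \<open>w\<close>, and so
    \<open>N h \<le> W\<close>.\<close>
  define N where "N h = (\<integral>t. (cmod (h (cis t)))\<^sup>2 / w t \<partial>M)" for h :: "complex \<Rightarrow> complex"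
  have cont: "continuous_on UNIV (\<lambda>t. h (cis t))" if "h analytic_on cball 0 1" for h
    using continuous_on_circle_shift[OF holomorphic_on_imp_continuous_on[OF analytic_imp_holomorphic[OF that]], of UNIV 0]
    by simp
  have iN: "integrable M (\<lambda>t. (cmod (h (cis t)))\<^sup>2 / w t)"
    and iL: "integrable M (\<lambda>t. cmod (h (cis t)))" if "h analytic_on cball 0 1" for h
  proof -
    have hm[measurable]: "(\<lambda>t. h (cis t)) \<in> borel_measurable borel"
      using cont[OF that] by (rule borel_measurable_continuous_onI)
    have "continuous_on (cball 0 1) h"
      using that analytic_imp_holomorphic holomorphic_on_imp_continuous_on by blast
    then have "bounded (h ` cball 0 1)"
      by (intro compact_imp_bounded compact_continuous_image) auto
    then obtain B where B: "\<And>z. z \<in> cball 0 1 \<Longrightarrow> cmod (h z) \<le> B"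
      unfolding bounded_iff by (metis imageI)
    have Bc: "cmod (h (cis t)) \<le> B" for t by (intro B) simp
    show "integrable M (\<lambda>t. cmod (h (cis t)))"
    proof (rule integrable_const_bound[where B = B])
      show "(\<lambda>t. cmod (h (cis t))) \<in> borel_measurable M" by (rule meas) measurable
    qed (use Bc in simp)
    have "(cmod (h (cis t)))\<^sup>2 / w t \<le> B\<^sup>2" for t
    proof -
      have "(cmod (h (cis t)))\<^sup>2 / w t \<le> (cmod (h (cis t)))\<^sup>2 / 1"
        using w1[of t] by (intro divide_left_mono) auto
      also have "\<dots> \<le> B\<^sup>2" using Bc[of t] by (simp add: power_mono)
      finally show ?thesis .
    qed
    then show "integrable M (\<lambda>t. (cmod (h (cis t)))\<^sup>2 / w t)"
      using w0 by (intro integrable_const_bound[where B = "B\<^sup>2"] meas) (simp_all add: less_imp_le)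
  qed
  \<comment> \<open>Decreasing convex sets: radius and tolerance both tighten with \<open>n\<close>,
    so that a sequence of members converges to \<open>f\<close> pointwise on the open disc.\<close>
  define A where "A n = {h. h analytic_on cball 0 1 \<and>
     (\<forall>z. cmod z \<le> 1 - 1 / real (Suc n) \<longrightarrow> cmod (h z - f z) \<le> 1 / real (Suc n))}" for n
  have AD: "h analytic_on cball 0 1" if "h \<in> A n" for h n using that by (simp add: A_def)
  have Amono: "A m \<subseteq> A n" if "n \<le> m" for n m
  proof -
    have "1 / real (Suc m) \<le> 1 / real (Suc n)" using that by (simp add: field_simps)
    then have le: "1 - 1 / real (Suc n) \<le> 1 - 1 / real (Suc m)" by linarith
    show ?thesis
    proof
      fix h assume h: "h \<in> A m"
      have "cmod (h z - f z) \<le> 1 / real (Suc n)" if "cmod z \<le> 1 - 1 / real (Suc n)" for z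
      proof -
        have "cmod z \<le> 1 - 1 / real (Suc m)" using that le by (rule order_trans)
        then have "cmod (h z - f z) \<le> 1 / real (Suc m)" using h unfolding A_def by blast
        then show ?thesis using le by linarith
      qed
      then show "h \<in> A n" using h unfolding A_def by blast
    qed
  qed
  have Amid: "(\<lambda>z. (h z + k z) / 2) \<in> A n" if "h \<in> A n" "k \<in> A n" for h k n
  proof -
    have "cmod ((h z + k z) / 2 - f z) \<le> 1 / real (Suc n)" if "cmod z \<le> 1 - 1 / real (Suc n)" for z
    proof -
      have "(h z + k z) / 2 - f z = ((h z - f z) + (k z - f z)) / 2" by (simp add: field_simps)
      then have "cmod ((h z + k z) / 2 - f z) \<le> (cmod (h z - f z) + cmod (k z - f z)) / 2"
        using norm_triangle_ineq[of "h z - f z" "k z - f z"] by (simp only: norm_divide) simp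
      also have "\<dots> \<le> (1 / real (Suc n) + 1 / real (Suc n)) / 2"
      proof (intro divide_right_mono add_mono)
        show "cmod (h z - f z) \<le> 1 / real (Suc n)" "cmod (k z - f z) \<le> 1 / real (Suc n)"
          using that \<open>h \<in> A n\<close> \<open>k \<in> A n\<close> unfolding A_def by blast+
      qed simp
      also have "(x + x) / 2 = x" for x :: real by simp
      finally show ?thesis .
    qed
    then show ?thesis using that by (auto simp: A_def intro!: analytic_intros)
  qed
  have Aex: "\<exists>h\<in>A n. N h \<le> W" for n
  proof -
    obtain s where s: "0 \<le> s" "s < 1"
      "\<And>z. cmod z \<le> 1 - 1 / real (Suc n) \<Longrightarrow> cmod (f (of_real s * z) - f z) \<le> 1 / real (Suc n)"
      by (rule dilate_close[OF f, of "1 - 1 / real (Suc n)" "1 / real (Suc n)"]) (auto simp: field_simps)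
    define h where "h z = f (of_real s * z)" for z
    have h: "h \<in> A n" unfolding A_def h_def using s analytic_on_dilate[OF f s(1,2)] by blast
    have "N h \<le> W" unfolding N_def W_def
    proof (rule integral_mono_AE[OF iN[OF AD[OF h]] iw])
      show "AE t in M. (cmod (h (cis t)))\<^sup>2 / w t \<le> w t"
        using AEF
      proof eventually_elim
        case (elim t)
        have "cmod (h (cis t)) \<le> enn2real (F t)"
          using bd[OF s(1,2), of t] elim by (cases "F t") (auto simp: h_def)
        then have "cmod (h (cis t)) \<le> w t" by (simp add: w_def)
        then have "(cmod (h (cis t)))\<^sup>2 \<le> (w t)\<^sup>2" by (simp add: power_mono)
        then show ?case using w0[of t] by (simp add: pos_divide_le_eq power2_eq_square)
      qed
    qed
    with h show ?thesis by blast
  qed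
  have N0: "0 \<le> N h" for h unfolding N_def using w0 by (intro integral_nonneg_AE) (simp add: less_imp_le)
  \<comment> \<open>The infima increase because the sets shrink, and stay below \<open>W\<close>
    because each set contains a dilate of \<open>f\<close>; hence they converge.\<close>
  define d where "d n = Inf (N ` A n)" for n
  have bdd: "bdd_below (N ` A n)" for n using N0 by (intro bdd_belowI[of _ 0]) auto
  have d_le: "d n \<le> N h" if "h \<in> A n" for h n
    unfolding d_def using that bdd by (intro cINF_lower) auto
  have d_mono: "d n \<le> d m" if "n \<le> m" for n m
    unfolding d_def using Amono[OF that] Aex[of m] bdd by (intro cINF_superset_mono) auto
  have "d n \<le> W" for n using Aex[of n] d_le order_trans by blast
  then obtain L where "d \<longlonglongrightarrow> L"
    using d_mono incseq_convergent[of d W] by (metis incseq_def)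
  then have dC: "Cauchy d" by (rule LIMSEQ_imp_Cauchy)
  have "\<exists>h\<in>A n. N h < d n + 1 / real (Suc n)" for n
  proof -
    have "Inf (N ` A n) < d n + 1 / real (Suc n)" by (simp add: d_def)
    then show ?thesis using Aex[of n] by (subst (asm) cInf_less_iff) (auto simp: bdd)
  qed
  then obtain g where gA: "\<And>n. g n \<in> A n" and gN: "\<And>n. N (g n) < d n + 1 / real (Suc n)"
    by metis
  have gan: "g n analytic_on cball 0 1" for n using gA AD by blast
  \<comment> \<open>The midpoint of \<open>g n\<close> and \<open>g m\<close> belongs to
    \<open>A n\<close>, so its squared norm is at least \<open>d n\<close>; the parallelogram law
    then leaves only the gap between the infima and the near-minimality errors.\<close>
  have diff: "N (\<lambda>z. (g n z - g m z) / 2) \<le> (d m - d n) + 1 / real (Suc n)" if "n \<le> m" for n m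
  proof -
    have gmn: "g m \<in> A n" using Amono[OF that] gA by blast
    have mid: "(\<lambda>z. (g n z + g m z) / 2) \<in> A n" by (rule Amid[OF gA gmn])
    have "N (\<lambda>z. (g n z - g m z) / 2) = N (g n) / 2 + N (g m) / 2 - N (\<lambda>z. (g n z + g m z) / 2)"
    proof -
      have "(cmod ((a - b) / 2))\<^sup>2 / x = (cmod a)\<^sup>2 / x / 2 + (cmod b)\<^sup>2 / x / 2 - (cmod ((a + b) / 2))\<^sup>2 / x"
        for a b x
        unfolding complex_parallelogram by (simp add: add_divide_distrib diff_divide_distrib)
      then have "N (\<lambda>z. (g n z - g m z) / 2) = (\<integral>t. (cmod (g n (cis t)))\<^sup>2 / w t / 2 +
          (cmod (g m (cis t)))\<^sup>2 / w t / 2 - (cmod ((g n (cis t) + g m (cis t)) / 2))\<^sup>2 / w t \<partial>M)"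
        unfolding N_def by (simp only:)
      also have "\<dots> = (\<integral>t. (cmod (g n (cis t)))\<^sup>2 / w t / 2 + (cmod (g m (cis t)))\<^sup>2 / w t / 2 \<partial>M)
          - N (\<lambda>z. (g n z + g m z) / 2)"
        unfolding N_def
        by (intro Bochner_Integration.integral_diff Bochner_Integration.integrable_add
            integrable_divide iN gan AD[OF mid])
      also have "(\<integral>t. (cmod (g n (cis t)))\<^sup>2 / w t / 2 + (cmod (g m (cis t)))\<^sup>2 / w t / 2 \<partial>M)
          = N (g n) / 2 + N (g m) / 2"
        unfolding N_def Bochner_Integration.integral_divide_zero[symmetric]
        by (intro Bochner_Integration.integral_add integrable_divide iN gan)
      finally show ?thesis .
    qed
    moreover have "d n \<le> N (\<lambda>z. (g n z + g m z) / 2)" using d_le[OF mid] .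
    moreover have "1 / real (Suc m) \<le> 1 / real (Suc n)" using that by (simp add: field_simps)
    moreover have "d n \<le> d m" using d_mono that by blast
    ultimately show ?thesis using gN[of n] gN[of m] by simp
  qed
  show ?thesis
  proof
    show "g n analytic_on cball 0 1" for n by (rule gan)
    show "(\<lambda>n. g n z) \<longlonglongrightarrow> f z" if z: "z \<in> ball 0 1" for z
    proof (rule Lim_transform_bound[where g = "\<lambda>n. 1 / real (Suc n)" and f = "\<lambda>n. g n z - f z", THEN LIM_zero_cancel])
      obtain k where k: "1 / real (Suc k) < 1 - cmod z"
        using z by (metis diff_gt_0_iff_gt inverse_eq_divide mem_ball_0 reals_Archimedean)
      show "\<forall>\<^sub>F n in sequentially. cmod (g n z - f z) \<le> norm (1 / real (Suc n))"
        using eventually_ge_at_top[of k]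
      proof eventually_elim
        case (elim n)
        then have "1 / real (Suc n) \<le> 1 / real (Suc k)" by (simp add: field_simps)
        then have "cmod z \<le> 1 - 1 / real (Suc n)" using k by linarith
        then show ?case using gA[of n] by (auto simp: A_def)
      qed
    qed (rule LIMSEQ_Suc[OF lim_1_over_n])
    fix e :: real assume "0 < e"
    \<comment> \<open>Chosen so that \<delta> (W + 1) = e / 2; the remaining factor 2 is the halving
      in \<open>h\<close>.\<close>
    define \<delta> where "\<delta> = e / (2 * (W + 1))"
    have W0: "0 \<le> W" unfolding W_def using w0 by (intro integral_nonneg_AE) (simp add: less_imp_le)
    have \<delta>: "0 < \<delta>" using \<open>0 < e\<close> W0 by (simp add: \<delta>_def)
    then have "0 < \<delta>\<^sup>2 / 2" by simp
    then obtain k1 where k1: "\<And>m n. m \<ge> k1 \<Longrightarrow> n \<ge> k1 \<Longrightarrow> dist (d m) (d n) < \<delta>\<^sup>2 / 2"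
      using dC unfolding Cauchy_def by metis
    obtain k2 where k2: "1 / real (Suc k2) < \<delta>\<^sup>2 / 2"
      using \<open>0 < \<delta>\<^sup>2 / 2\<close> by (metis inverse_eq_divide reals_Archimedean)
    have "integral {0..2 * pi} (\<lambda>t. cmod (g n (cis t) - g m (cis t))) \<le> e"
      if "n \<ge> max k1 k2" "m \<ge> n" for n m
    proof -
      define h where "h z = (g n z - g m z) / 2" for z
      have h: "h analytic_on cball 0 1" unfolding h_def using gan by (auto intro!: analytic_intros)
      have "1 / real (Suc n) \<le> 1 / real (Suc k2)" using that by (simp add: field_simps)
      moreover have "d m - d n < \<delta>\<^sup>2 / 2" using k1[of m n] that unfolding dist_real_def by (meson abs_ge_self le_less_trans max.boundedE order_trans)
      ultimately have Nh: "N h \<le> \<delta>\<^sup>2" using diff[OF that(2)] k2 by (simp add: h_def[abs_def])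
      have "(\<integral>t. cmod (h (cis t)) \<partial>M) \<le> (\<integral>t. \<delta> * w t + ((cmod (h (cis t)))\<^sup>2 / w t) / \<delta> \<partial>M)"
        by (intro integral_mono iL[OF h] Bochner_Integration.integrable_add integrable_mult_right iw
              integrable_divide iN[OF h] le_weighted_square w0 \<delta>)
      also have "\<dots> = \<delta> * W + N h / \<delta>"
        unfolding W_def N_def Bochner_Integration.integral_divide_zero[symmetric]
          Bochner_Integration.integral_mult_right_zero[symmetric]
        by (intro Bochner_Integration.integral_add integrable_mult_right integrable_divide iw iN[OF h])
      also have "\<dots> \<le> \<delta> * W + \<delta>\<^sup>2 / \<delta>"
        using Nh \<delta> by (intro add_left_mono divide_right_mono) auto
      also have "\<dots> = e / 2"
      proof -
        have "\<delta> * (W + 1) = e / 2" using W0 by (simp add: \<delta>_def field_simps)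
        then show ?thesis using \<delta> by (simp add: power2_eq_square algebra_simps)
      qed
      finally have "(\<integral>t. cmod (h (cis t)) \<partial>M) \<le> e / 2" .
      moreover have "(\<integral>t. cmod (h (cis t)) \<partial>M) = integral {0..2 * pi} (\<lambda>t. cmod (h (cis t)))"
      proof -
        have "set_integrable lborel {0..2 * pi} (\<lambda>t. cmod (h (cis t)))"
          using cont[OF h] by (intro borel_integrable_atLeastAtMost' continuous_intros) (rule continuous_on_subset, auto)
        from set_borel_integral_eq_integral(2)[OF this] show ?thesis
          by (simp add: M_def integral_restrict_space set_lebesgue_integral_def)
      qed
      moreover have "integral {0..2 * pi} (\<lambda>t. cmod (h (cis t)))
          = integral {0..2 * pi} (\<lambda>t. cmod (g n (cis t) - g m (cis t))) / 2"
        by (simp add: h_def norm_divide)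
      ultimately show ?thesis by simp
    qed
    then show "\<exists>k. \<forall>n\<ge>k. \<forall>m\<ge>n.
        integral {0..2 * pi} (\<lambda>t. cmod (g n (cis t) - g m (cis t))) \<le> e" by blast
  qed
qed

text \<open>A form of Fatou's theorem. Consecutive terms of a subsequence at L^1 distance at most
  4^-k differ by at most 2^-k on all rays outside a set of measure at most 10 times 2^-k. The
  measures are summable, so almost every ray meets only finitely many of these sets; on such a ray
  the telescoping series converges uniformly, and its limit is \<open>f\<close>.\<close>

theorem radial_uniformly_continuous_AE:
  fixes f :: "complex \<Rightarrow> complex" and F :: "real \<Rightarrow> ennreal"
  assumes f: "f holomorphic_on ball 0 1"
    and F: "F \<in> borel_measurable borel"
    and bd: "\<And>r t. 0 \<le> r \<Longrightarrow> r < 1 \<Longrightarrow> ennreal (cmod (f (of_real r * cis t))) \<le> F t"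
    and fin: "(\<integral>\<^sup>+t\<in>{0..2 * pi}. F t \<partial>lborel) < \<infinity>"
  shows "AE t in lborel. t \<in> {0..2 * pi} \<longrightarrow>
           uniformly_continuous_on {0..<1} (\<lambda>r. f (of_real r * cis t))"
proof -
  obtain g where g: "\<And>n. g n analytic_on cball 0 1"
    "\<And>z. z \<in> ball 0 1 \<Longrightarrow> (\<lambda>n. g n z) \<longlonglongrightarrow> f z"
    "\<And>e. 0 < e \<Longrightarrow> \<exists>k. \<forall>n\<ge>k. \<forall>m\<ge>n.
        integral {0..2 * pi} (\<lambda>t. cmod (g n (cis t) - g m (cis t))) \<le> e"
    by (rule L1_circle_approximation[OF assms]) blast+
  have "\<forall>k. \<exists>j. \<forall>n\<ge>j. \<forall>m\<ge>n.
        integral {0..2 * pi} (\<lambda>t. cmod (g n (cis t) - g m (cis t))) \<le> (1 / 4) ^ k"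
    using g(3) by simp
  then obtain \<nu> where \<nu>: "\<And>k n m. n \<ge> \<nu> k \<Longrightarrow> m \<ge> n \<Longrightarrow>
        integral {0..2 * pi} (\<lambda>t. cmod (g n (cis t) - g m (cis t))) \<le> (1 / 4) ^ k"
    by metis
  \<comment> \<open>Summing the thresholds makes the index monotone and large enough for each
    tolerance; the summand \<open>k\<close> forces it to infinity, as the pointwise convergence
    needs.\<close>
  define \<sigma> where "\<sigma> k = k + (\<Sum>i\<le>k. \<nu> i)" for k
  have \<sigma>: "\<nu> k \<le> \<sigma> k" "\<sigma> k \<le> \<sigma> (Suc k)" "k \<le> \<sigma> k" for k
    by (auto simp: \<sigma>_def intro: trans_le_add2 member_le_sum)
  define h where "h k z = g (\<sigma> k) z - g (\<sigma> (Suc k)) z" for k z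
  have hol: "h k holomorphic_on cball 0 1" for k
    unfolding h_def using g(1) by (intro analytic_imp_holomorphic analytic_intros)
  have "\<exists>V. V \<in> sets lborel \<and>
    (\<forall>t\<in>{0..2 * pi} - V. \<forall>r\<in>{0..<1}. cmod (h k (of_real r * cis t)) \<le> (1 / 2) ^ k) \<and>
    emeasure lborel V \<le> ennreal (10 * (1 / 2) ^ k)" for k
  proof -
    obtain V where V: "V \<in> sets lborel"
      "\<And>t r. t \<in> {0..2 * pi} \<Longrightarrow> t \<notin> V \<Longrightarrow> 0 \<le> r \<Longrightarrow> r < 1 \<Longrightarrow> cmod (h k (of_real r * cis t)) \<le> (1 / 2) ^ k"
      "emeasure lborel V \<le> ennreal (10 / (1 / 2) ^ k * integral {0..2 * pi} (\<lambda>t. cmod (h k (cis t))))"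
      by (rule radial_weak_type[OF hol, of "(1 / 2) ^ k"]) auto
    \<comment> \<open>The weak type factor at level 2^-k costs 2^k; the distance 4^-k pays for it
      and leaves a summable 2^-k.\<close>
    have "10 / (1 / 2) ^ k * integral {0..2 * pi} (\<lambda>t. cmod (h k (cis t))) \<le> 10 / (1 / 2) ^ k * (1 / 4) ^ k"
      unfolding h_def using \<sigma> by (intro mult_left_mono \<nu>) auto
    also have "\<dots> = 10 * (1 / 2) ^ k"
      by (simp add: power_divide field_simps flip: power_mult_distrib)
    finally show ?thesis using V by (meson DiffE atLeastLessThan_iff ennreal_leI order_trans)
  qed
  then obtain V where V: "\<And>k. V k \<in> sets lborel"
    "\<And>k t r. t \<in> {0..2 * pi} \<Longrightarrow> t \<notin> V k \<Longrightarrow> r \<in> {0..<1} \<Longrightarrow> cmod (h k (of_real r * cis t)) \<le> (1 / 2) ^ k"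
    "\<And>k. emeasure lborel (V k) \<le> ennreal (10 * (1 / 2) ^ k)"
    by (metis DiffI)
  have "AE t in lborel. \<forall>\<^sub>F k in sequentially. t \<in> space lborel - V k"
  proof (rule borel_cantelli_AE1[OF V(1)])
    show "emeasure lborel (V k) < \<infinity>" for k
      using V(3)[of k] by (rule order_le_less_trans) simp
    have "measure lborel (V k) \<le> 10 * (1 / 2) ^ k" for k
      unfolding measure_def by (rule enn2real_leI[OF _ V(3)]) simp
    moreover have "summable (\<lambda>k. 10 * (1 / 2 :: real) ^ k)"
      by (intro summable_mult summable_geometric) simp
    ultimately show "summable (\<lambda>k. measure lborel (V k))"
      by (auto intro: summable_comparison_test'[where g = "\<lambda>k. 10 * (1 / 2) ^ k"])
  qed
  then show ?thesis
  proof eventually_elim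
    case (elim t)
    show ?case
    proof
      assume t: "t \<in> {0..2 * pi}"
      define a where "a k r = g (\<sigma> k) (of_real r * cis t)" for k r
      obtain k0 where k0: "\<And>k. k \<ge> k0 \<Longrightarrow> t \<notin> V k"
        using elim by (auto simp: eventually_sequentially)
      have step: "cmod (a k r - a (Suc k) r) \<le> (1 / 2) ^ k" if "k \<ge> k0" "r \<in> {0..<1}" for k r
        using V(2)[OF t k0[OF that(1)] that(2)] by (simp add: a_def h_def)
      \<comment> \<open>The bound is the partial sum of the geometric series in closed form; the
        subtracted term lets the induction close.\<close>
      have steps: "cmod (a k r - a (k + j) r) \<le> 2 * (1 / 2) ^ k - 2 * (1 / 2) ^ (k + j)"
        if "k \<ge> k0" "r \<in> {0..<1}" for k r j
      proof (induction j)
        case (Suc j)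
        have "cmod (a k r - a (k + Suc j) r) \<le> cmod (a k r - a (k + j) r) + cmod (a (k + j) r - a (Suc (k + j)) r)"
          using norm_triangle_ineq[of "a k r - a (k + j) r" "a (k + j) r - a (Suc (k + j)) r"] by simp
        also have "\<dots> \<le> 2 * (1 / 2) ^ k - 2 * (1 / 2) ^ (k + j) + (1 / 2) ^ (k + j)"
          using Suc step[of "k + j" r] that by (intro add_mono) auto
        finally show ?case by simp
      qed simp
      have lim: "(\<lambda>k. a k r) \<longlonglongrightarrow> f (of_real r * cis t)" if "r \<in> {0..<1}" for r
      proof -
        have "filterlim \<sigma> at_top sequentially"
          using \<sigma>(3) by (rule filterlim_at_top_mono[OF filterlim_ident, OF always_eventually, OF allI])
        moreover have "(\<lambda>n. g n (of_real r * cis t)) \<longlonglongrightarrow> f (of_real r * cis t)"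
          using that by (intro g(2)) (simp add: norm_mult)
        ultimately show ?thesis unfolding a_def by (rule filterlim_compose[rotated])
      qed
      \<comment> \<open>The limit in \<open>j\<close> of the previous estimate. The bound is
        independent of \<open>r\<close>, which gives uniform convergence along the ray.\<close>
      have bound: "cmod (a k r - f (of_real r * cis t)) \<le> 2 * (1 / 2) ^ k" if "k \<ge> k0" "r \<in> {0..<1}" for k r
      proof (rule tendsto_upperbound)
        show "(\<lambda>j. cmod (a k r - a (j + k) r)) \<longlonglongrightarrow> cmod (a k r - f (of_real r * cis t))"
          by (intro tendsto_intros LIMSEQ_ignore_initial_segment lim that)
        show "\<forall>\<^sub>F j in sequentially. cmod (a k r - a (j + k) r) \<le> 2 * (1 / 2) ^ k"
          using steps[OF that] by (intro always_eventually allI) (smt (verit) add.commute zero_le_divide_1_iff zero_le_power)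
      qed simp
      show "uniformly_continuous_on {0..<1} (\<lambda>r. f (of_real r * cis t))"
      proof (rule uniformly_continuous_on_uniform_limit)
        show "\<forall>\<^sub>F k in sequentially. uniformly_continuous_on {0..<1} (a k)"
          unfolding a_def by (intro always_eventually allI uniformly_continuous_on_ray g(1))
        show "uniform_limit {0..<1} a (\<lambda>r. f (of_real r * cis t)) sequentially"
        proof (rule uniform_limitI)
          fix e :: real assume "0 < e"
          have "(\<lambda>k. 2 * (1 / 2) ^ k :: real) \<longlonglongrightarrow> 2 * 0"
            by (intro tendsto_intros LIMSEQ_realpow_zero) auto
          then have "\<forall>\<^sub>F k in sequentially. 2 * (1 / 2) ^ k < e"
            by (rule order_tendstoD(2)) (simp add: \<open>0 < e\<close>)
          then show "\<forall>\<^sub>F k in sequentially. \<forall>r\<in>{0..<1}. dist (a k r) (f (of_real r * cis t)) < e"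
            using eventually_ge_at_top[of k0]
            by eventually_elim (use bound in \<open>force simp: dist_norm\<close>)
        qed
      qed
    qed
  qed
qed

subsection \<open>Norms of extended nonnegative functions\<close>

lemma enn_powr_ennreal [simp]: "0 \<le> x \<Longrightarrow> enn_powr (ennreal x) a = ennreal (x powr a)"
  by (simp add: enn_powr_def)

lemma enn_powr_infinity [simp]: "enn_powr \<infinity> a = \<infinity>" "enn_powr top a = \<infinity>"
  by (simp_all add: enn_powr_def)

lemma enn_powr_0 [simp]: "enn_powr 0 a = 0"
  by (simp add: enn_powr_def)

lemma enn_powr_mono: "x \<le> y \<Longrightarrow> 0 \<le> a \<Longrightarrow> enn_powr x a \<le> enn_powr y a"
  by (cases x; cases y) (auto intro!: ennreal_leI powr_mono2 simp: top_unique)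

lemma enn_powr_powr: "enn_powr (enn_powr x a) b = enn_powr x (a * b)"
  by (cases x) (auto simp: powr_powr)

lemma enn_powr_one [simp]: "enn_powr x 1 = x"
  by (cases x) auto

lemma enn_powr_mult: "enn_powr (x * y) a = enn_powr x a * enn_powr y a"
  by (cases x; cases y)
     (auto simp: ennreal_mult_top ennreal_top_mult powr_mult ennreal_eq_0_iff powr_eq_0_iff
        simp flip: ennreal_mult)

lemma enn_powr_eq_0_iff [simp]: "enn_powr x a = 0 \<longleftrightarrow> x = 0"
  by (cases x) (auto simp: ennreal_eq_0_iff)

lemma enn_powr_less_top_iff [simp]: "enn_powr x a < top \<longleftrightarrow> x < top"
  by (cases x) auto

lemma measurable_enn_powr [measurable (raw)]:
  assumes [measurable]: "F \<in> borel_measurable M"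
  shows "(\<lambda>x. enn_powr (F x) a) \<in> borel_measurable M"
  unfolding enn_powr_def by simp

lemma tendsto_enn_powr_0:
  assumes "(F \<longlongrightarrow> 0) net" and a: "0 < a"
  shows "((\<lambda>x. enn_powr (F x) a) \<longlongrightarrow> 0) net"
proof (rule order_tendstoI)
  fix y :: ennreal assume "0 < y"
  have *: "\<forall>\<^sub>F x in net. F x < enn_powr y (1 / a)"
    using \<open>0 < y\<close> by (intro order_tendstoD(2)[OF assms(1)]) (simp add: zero_less_iff_neq_zero)
  show "\<forall>\<^sub>F x in net. enn_powr (F x) a < y"
    using *
  proof eventually_elim
    case (elim x)
    show ?case
    proof (rule ccontr)
      assume "\<not> ?case"
      then have "enn_powr y (1 / a) \<le> enn_powr (enn_powr (F x) a) (1 / a)"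
        using a by (intro enn_powr_mono) auto
      with elim a show False by (simp add: enn_powr_powr)
    qed
  qed
qed simp

text \<open>For finite p, \<open>rho\<close> iterates such norms, over the ray and then over the
  angle. Values in [0, \<infinity>] let a possibly infinite inner norm be the argument of the outer
  one.\<close>

definition Lq_norm :: "'a measure \<Rightarrow> real \<Rightarrow> ('a \<Rightarrow> ennreal) \<Rightarrow> ennreal"
  where "Lq_norm M q F = enn_powr (\<integral>\<^sup>+x. enn_powr (F x) q \<partial>M) (1 / q)"

lemma enn_powr_Lq_norm: "0 < q \<Longrightarrow> enn_powr (Lq_norm M q F) q = (\<integral>\<^sup>+x. enn_powr (F x) q \<partial>M)"
  by (simp add: Lq_norm_def enn_powr_powr)

lemma Lq_norm_mono:
  assumes "\<And>x. x \<in> space M \<Longrightarrow> F x \<le> G x" "0 \<le> q"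
  shows "Lq_norm M q F \<le> Lq_norm M q G"
  unfolding Lq_norm_def using assms by (intro enn_powr_mono nn_integral_mono) auto

lemma Lq_norm_cmult:
  assumes "F \<in> borel_measurable M" "0 < q"
  shows "Lq_norm M q (\<lambda>x. c * F x) = c * Lq_norm M q F"
  using assms by (simp add: Lq_norm_def enn_powr_mult nn_integral_cmult enn_powr_powr)

lemma Lq_norm_const:
  "0 < q \<Longrightarrow> Lq_norm M q (\<lambda>x. c) = c * enn_powr (emeasure M (space M)) (1 / q)"
  by (simp add: Lq_norm_def enn_powr_mult enn_powr_powr)

lemma Lq_norm_eq_0_AE:
  assumes "F \<in> borel_measurable M" "Lq_norm M q F = 0"
  shows "AE x in M. F x = 0"
proof -
  have "(\<integral>\<^sup>+x. enn_powr (F x) q \<partial>M) = 0" using assms(2) by (simp add: Lq_norm_def)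
  then show ?thesis using assms(1) by (subst (asm) nn_integral_0_iff_AE) auto
qed

lemma Lq_norm_less_top_AE:
  assumes [measurable]: "F \<in> borel_measurable M" and "Lq_norm M q F < \<infinity>"
  shows "AE x in M. F x < \<infinity>"
proof -
  have "(\<integral>\<^sup>+x. enn_powr (F x) q \<partial>M) \<noteq> \<infinity>" using assms(2) by (auto simp: Lq_norm_def less_top)
  then have "AE x in M. enn_powr (F x) q \<noteq> \<infinity>" by (intro nn_integral_PInf_AE) auto
  then show ?thesis by eventually_elim (auto simp: less_top)
qed

text \<open>If one argument is 0, convexity reduces to \<open>s powr p \<le> s\<close> for 0 < s <
  1; otherwise it is convexity on the open half-line.\<close>

lemma convex_on_powr:
  assumes p: "(1 :: real) \<le> p"
  shows "convex_on {0..} (\<lambda>x. x powr p)"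
proof (rule convex_onI)
  fix t x y :: real
  assume t: "0 < t" "t < 1" and xy: "x \<in> {0..}" "y \<in> {0..}"
  have small: "(s * z) powr p \<le> s * z powr p" if "0 < s" "s < 1" "0 \<le> z" for s z :: real
  proof -
    have "s powr p \<le> s powr 1" using that p by (intro powr_mono') auto
    then have "s powr p * z powr p \<le> s * z powr p" using that by (intro mult_right_mono) auto
    then show ?thesis by (simp add: powr_mult)
  qed
  show "((1 - t) *\<^sub>R x + t *\<^sub>R y) powr p \<le> (1 - t) * x powr p + t * y powr p"
  proof (cases "x = 0 \<or> y = 0")
    case True
    then show ?thesis using t xy small[of t y] small[of "1 - t" x] by auto
  next
    case False
    then show ?thesis using t xy convex_onD[OF powr_convex[OF p], of t x y] by simp
  qed
qed simp

text \<open>Jensen's inequality: (x + y) / (a + b) is the mean of x / a and y / b with weights a /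
  (a + b) and b / (a + b). With \<open>a\<close> and \<open>b\<close> just above the norms of the
  two summands, integration yields Minkowski's inequality.\<close>

lemma powr_add_le_weighted:
  fixes a b x y p :: real
  assumes "0 < a" "0 < b" "0 \<le> x" "0 \<le> y" "1 \<le> p"
  shows "(x + y) powr p \<le> (a + b) powr (p - 1) * (a powr (1 - p) * x powr p + b powr (1 - p) * y powr p)"
proof -
  have cv: "convex_on {0..} (\<lambda>x :: real. x powr p)"
    using assms(5) by (rule convex_on_powr)
  define c where "c = a / (a + b)"
  have c: "0 \<le> c" "c \<le> 1" "1 - c = b / (a + b)" using assms by (auto simp: c_def field_simps)
  have eq: "(1 - c) *\<^sub>R (y / b) + c *\<^sub>R (x / a) = (x + y) / (a + b)"
    using assms unfolding c(3) by (simp add: c_def add_divide_distrib add.commute)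
  have "((x + y) / (a + b)) powr p \<le> (1 - c) * (y / b) powr p + c * (x / a) powr p"
    using convex_onD[OF cv c(1,2), of "y / b" "x / a"] assms eq by simp
  then have "(a + b) powr p * ((x + y) / (a + b)) powr p
     \<le> (a + b) powr p * ((1 - c) * (y / b) powr p + c * (x / a) powr p)"
    by (intro mult_left_mono) auto
  also have "(a + b) powr p * ((x + y) / (a + b)) powr p = (x + y) powr p"
    using assms by (simp flip: powr_mult)
  also have "(a + b) powr p * ((1 - c) * (y / b) powr p + c * (x / a) powr p)
    = (a + b) powr (p - 1) * (a powr (1 - p) * x powr p + b powr (1 - p) * y powr p)"
  proof -
    have "(a + b) powr p = (a + b) powr (p - 1) * (a + b)"
      using assms by (simp add: powr_diff)
    moreover have "a powr (1 - p) = a / a powr p" "b powr (1 - p) = b / b powr p"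
      using assms by (simp_all add: powr_diff)
    moreover have "(a + b) * ((1 - c) * Y + c * X) = a * X + b * Y" for X Y
    proof -
      have "S * (b / S * Y + a / S * X) = a * X + b * Y" if "S \<noteq> 0" for S
        using that by (simp add: field_simps)
      then show ?thesis unfolding c(3) unfolding c_def using assms by simp
    qed
    moreover have "a * (x / a) powr p = a powr (1 - p) * x powr p" "b * (y / b) powr p = b powr (1 - p) * y powr p"
      using assms by (simp_all add: powr_divide powr_diff)
    ultimately show ?thesis
      by (simp only: mult.assoc)
  qed
  finally show ?thesis .
qed

lemma Lq_norm_triangle:
  assumes F[measurable]: "F \<in> borel_measurable M" and G[measurable]: "G \<in> borel_measurable M"
    and q: "1 \<le> q"
  shows "Lq_norm M q (\<lambda>x. F x + G x) \<le> Lq_norm M q F + Lq_norm M q G"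
proof (cases "Lq_norm M q F = \<infinity> \<or> Lq_norm M q G = \<infinity>")
  case False
  then obtain A B where A: "Lq_norm M q F = ennreal A" "0 \<le> A" and B: "Lq_norm M q G = ennreal B" "0 \<le> B"
    by (cases "Lq_norm M q F"; cases "Lq_norm M q G") auto
  \<comment> \<open>Numbers strictly above the norms are positive even when a norm vanishes, as the
    weighted inequality requires.\<close>
  have le: "Lq_norm M q (\<lambda>x. F x + G x) \<le> ennreal (a + b)" if "A < a" "B < b" for a b
  proof -
    have ab: "0 < a" "0 < b" using that A B by auto
    define C where "C = (a + b) powr (q - 1)"
    have pw: "enn_powr (F x + G x) q \<le> ennreal C * (ennreal (a powr (1 - q)) * enn_powr (F x) q
        + ennreal (b powr (1 - q)) * enn_powr (G x) q)" for x
    proof (cases "F x = \<infinity> \<or> G x = \<infinity>")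
      case True
      then show ?thesis using ab by (auto simp: C_def ennreal_mult_top ennreal_top_mult add_top)
    next
      case False
      then obtain u v where "F x = ennreal u" "0 \<le> u" "G x = ennreal v" "0 \<le> v"
        by (cases "F x"; cases "G x") auto
      then show ?thesis
        using powr_add_le_weighted[OF ab, of u v q] q
        by (simp add: C_def flip: ennreal_plus ennreal_mult)
    qed
    have "(\<integral>\<^sup>+x. enn_powr (F x + G x) q \<partial>M) \<le>
      (\<integral>\<^sup>+x. ennreal C * (ennreal (a powr (1 - q)) * enn_powr (F x) q
        + ennreal (b powr (1 - q)) * enn_powr (G x) q) \<partial>M)"
      by (intro nn_integral_mono pw)
    also have "\<dots> = ennreal C * (ennreal (a powr (1 - q)) * enn_powr (Lq_norm M q F) q
        + ennreal (b powr (1 - q)) * enn_powr (Lq_norm M q G) q)"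
      using q by (simp add: nn_integral_cmult nn_integral_add enn_powr_Lq_norm)
    also have "\<dots> \<le> ennreal C * (ennreal (a powr (1 - q)) * enn_powr (ennreal a) q
        + ennreal (b powr (1 - q)) * enn_powr (ennreal b) q)"
      using that A B q by (intro mult_left_mono add_mono enn_powr_mono) (auto intro!: ennreal_leI)
    also have "\<dots> = ennreal ((a + b) powr q)"
      using ab by (simp add: C_def powr_diff flip: ennreal_plus ennreal_mult powr_add)
    finally have "enn_powr (\<integral>\<^sup>+x. enn_powr (F x + G x) q \<partial>M) (1 / q) \<le> enn_powr (ennreal ((a + b) powr q)) (1 / q)"
      using q by (intro enn_powr_mono) auto
    then show ?thesis
      using ab q by (simp add: Lq_norm_def powr_powr)
  qed
  have "Lq_norm M q (\<lambda>x. F x + G x) \<le> ennreal (A + B)"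
  proof (rule ennreal_le_epsilon)
    fix e :: real assume "0 < e"
    then show "Lq_norm M q (\<lambda>x. F x + G x) \<le> ennreal (A + B) + ennreal e"
      using le[of "A + e / 2" "B + e / 2"] A B by (simp add: algebra_simps flip: ennreal_plus)
  qed
  then show ?thesis using A B by simp
qed auto

lemma Lq_norm_dominated_convergence:
  fixes F :: "nat \<Rightarrow> 'a \<Rightarrow> ennreal"
  assumes F[measurable]: "\<And>n. F n \<in> borel_measurable M" and G[measurable]: "G \<in> borel_measurable M"
    and q: "0 < q" and dom: "\<And>n x. x \<in> space M \<Longrightarrow> F n x \<le> G x" and fin: "Lq_norm M q G < \<infinity>"
    and lim: "AE x in M. (\<lambda>n. F n x) \<longlonglongrightarrow> 0"
  shows "(\<lambda>n. Lq_norm M q (F n)) \<longlonglongrightarrow> 0"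
  unfolding Lq_norm_def
proof (rule tendsto_enn_powr_0)
  have "(\<lambda>n. \<integral>\<^sup>+x. enn_powr (F n x) q \<partial>M) \<longlonglongrightarrow> (\<integral>\<^sup>+x. 0 \<partial>M)"
  proof (rule nn_integral_dominated_convergence[where w = "\<lambda>x. enn_powr (G x) q"])
    show "AE x in M. enn_powr (F n x) q \<le> enn_powr (G x) q" for n
      using dom q by (intro AE_I2 enn_powr_mono) auto
    show "(\<integral>\<^sup>+x. enn_powr (G x) q \<partial>M) < \<infinity>"
      using fin q by (simp flip: enn_powr_Lq_norm)
    show "AE x in M. (\<lambda>n. enn_powr (F n x) q) \<longlonglongrightarrow> 0"
      using lim by eventually_elim (rule tendsto_enn_powr_0[OF _ q])
  qed auto
  then show "(\<lambda>n. \<integral>\<^sup>+x. enn_powr (F n x) q \<partial>M) \<longlonglongrightarrow> 0" by simp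
qed (use q in simp)

text \<open>Apply Fatou's lemma to \<open>2\<^sup>p (|u\<^sub>n|\<^sup>p + |v|\<^sup>p) - |u\<^sub>n - v|\<^sup>p \<ge> 0\<close>.\<close>

lemma nn_integral_powr_diff_tendsto_0:
  fixes u :: "nat \<Rightarrow> 'a \<Rightarrow> complex"
  assumes u[measurable]: "\<And>n. u n \<in> borel_measurable M" and v[measurable]: "v \<in> borel_measurable M"
    and p: "0 < p"
    and lim: "\<And>x. x \<in> space M \<Longrightarrow> (\<lambda>n. u n x) \<longlonglongrightarrow> v x"
    and fin: "(\<integral>\<^sup>+x. ennreal (cmod (v x) powr p) \<partial>M) < \<infinity>"
    and c: "c \<longlonglongrightarrow> 1" "\<And>n. 0 \<le> c n"
    and le: "\<And>n. (\<integral>\<^sup>+x. ennreal (cmod (u n x) powr p) \<partial>M)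
                \<le> ennreal (c n) * (\<integral>\<^sup>+x. ennreal (cmod (v x) powr p) \<partial>M)"
  shows "(\<lambda>n. \<integral>\<^sup>+x. ennreal (cmod (u n x - v x) powr p) \<partial>M) \<longlonglongrightarrow> 0"
proof -
  \<comment> \<open>With this constant \<open>\<psi>\<close> is nonnegative, since |u - v| is at
    most 2 max(|u|, |v|).\<close>
  define K where "K = (2 :: real) powr p"
  have K: "0 < K" by (simp add: K_def)
  define \<psi> where "\<psi> n x = K * (cmod (u n x) powr p + cmod (v x) powr p) - cmod (u n x - v x) powr p" for n x
  have [measurable]: "\<psi> n \<in> borel_measurable M" for n unfolding \<psi>_def by measurable
  have \<psi>0: "0 \<le> \<psi> n x" for n x
  proof -
    let ?m = "max (cmod (u n x)) (cmod (v x))"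
    have "cmod (u n x - v x) powr p \<le> (2 * ?m) powr p"
      using norm_triangle_ineq4[of "u n x" "v x"] p by (intro powr_mono2) auto
    also have "\<dots> = K * ?m powr p" by (simp add: K_def powr_mult)
    also have "\<dots> \<le> K * (cmod (u n x) powr p + cmod (v x) powr p)"
      using K by (intro mult_left_mono) (auto simp: max_def)
    finally show ?thesis by (simp add: \<psi>_def)
  qed
  obtain A where A: "(\<integral>\<^sup>+x. ennreal (cmod (v x) powr p) \<partial>M) = ennreal A" "0 \<le> A"
    using fin by (cases "\<integral>\<^sup>+x. ennreal (cmod (v x) powr p) \<partial>M") auto
  define I where "I n = (\<integral>\<^sup>+x. ennreal (\<psi> n x) \<partial>M)" for n
  define J where "J n = (\<integral>\<^sup>+x. ennreal (cmod (u n x - v x) powr p) \<partial>M)" for n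
  \<comment> \<open>In the sum the difference term cancels. As \<open>c n\<close> tends to 1, the
    bound tends to \<open>2 * K * A\<close>, which Fatou gives as a lower bound for \<open>I\<close>
    alone; nothing is left for \<open>J\<close>.\<close>
  have IJ: "I n + J n \<le> ennreal (K * (c n + 1) * A)" for n
  proof -
    have "I n + J n = (\<integral>\<^sup>+x. ennreal K * (ennreal (cmod (u n x) powr p) + ennreal (cmod (v x) powr p)) \<partial>M)"
      unfolding I_def J_def using \<psi>0 K
      by (subst nn_integral_add[symmetric])
         (auto simp: \<psi>_def simp flip: ennreal_plus ennreal_mult intro!: nn_integral_cong)
    also have "\<dots> = ennreal K * ((\<integral>\<^sup>+x. ennreal (cmod (u n x) powr p) \<partial>M) + ennreal A)"
      by (simp add: nn_integral_cmult nn_integral_add A)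
    also have "\<dots> \<le> ennreal K * (ennreal (c n) * ennreal A + ennreal A)"
      using le[of n] A by (intro mult_left_mono add_right_mono) auto
    also have "\<dots> = ennreal (K * (c n + 1) * A)"
      using K A c(2)[of n] by (simp add: algebra_simps flip: ennreal_plus ennreal_mult)
    finally show ?thesis .
  qed
  have "(\<integral>\<^sup>+x. liminf (\<lambda>n. ennreal (\<psi> n x)) \<partial>M) \<le> liminf I"
    unfolding I_def by (rule nn_integral_liminf) auto
  moreover have "(\<integral>\<^sup>+x. liminf (\<lambda>n. ennreal (\<psi> n x)) \<partial>M) = (\<integral>\<^sup>+x. ennreal (2 * K) * ennreal (cmod (v x) powr p) \<partial>M)"
  proof (rule nn_integral_cong)
    fix x assume "x \<in> space M"
    then have l: "(\<lambda>n. u n x) \<longlonglongrightarrow> v x" by (rule lim)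
    have "(\<lambda>n. cmod (u n x) powr p) \<longlonglongrightarrow> cmod (v x) powr p"
      using p by (intro tendsto_powr' tendsto_intros l) auto
    moreover have "(\<lambda>n. cmod (u n x - v x) powr p) \<longlonglongrightarrow> cmod (v x - v x) powr p"
      using p by (intro tendsto_powr' tendsto_intros l) auto
    ultimately have "(\<lambda>n. \<psi> n x) \<longlonglongrightarrow> K * (cmod (v x) powr p + cmod (v x) powr p) - cmod (v x - v x) powr p"
      unfolding \<psi>_def by (intro tendsto_diff tendsto_add tendsto_mult tendsto_const)
    then have "(\<lambda>n. ennreal (\<psi> n x)) \<longlonglongrightarrow> ennreal (2 * K * cmod (v x) powr p)"
      by (intro tendsto_ennrealI) (simp add: algebra_simps)
    then show "liminf (\<lambda>n. ennreal (\<psi> n x)) = ennreal (2 * K) * ennreal (cmod (v x) powr p)"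
      using K by (simp add: lim_imp_Liminf flip: ennreal_mult)
  qed
  moreover have "\<dots> = ennreal (2 * K * A)"
    using K A by (subst nn_integral_cmult) (simp_all flip: ennreal_mult)
  ultimately have fatou: "ennreal (2 * K * A) \<le> liminf I" by simp
  have "J \<longlonglongrightarrow> 0"
  proof (rule order_tendstoI)
    fix y :: ennreal assume "0 < y"
    then obtain e where e: "0 < e" "ennreal e < y"
      by (metis ennreal_0 ennreal_less_zero_iff dense ennreal_cases infinity_ennreal_def order_less_trans top.not_eq_extremum)
    have "(\<lambda>n. K * (c n + 1) * A) \<longlonglongrightarrow> K * (1 + 1) * A" by (intro tendsto_intros c)
    then have ev1: "\<forall>\<^sub>F n in sequentially. K * (c n + 1) * A < 2 * K * A + e / 2"
      using e(1) by (intro order_tendstoD(2)) (auto simp: algebra_simps)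
    have ev2: "\<forall>\<^sub>F n in sequentially. ennreal (2 * K * A - e / 2) \<le> I n"
    \<comment> \<open>Negative numbers are truncated to 0 by \<open>ennreal\<close>, so the strict
      inequality that the limes inferior calls for could fail in the first case.\<close>
    proof (cases "2 * K * A - e / 2 \<le> 0")
      case True
      then show ?thesis by (simp add: ennreal_neg)
    next
      case False
      then have "0 < 2 * K * A" "2 * K * A - e / 2 < 2 * K * A" using e(1) by linarith+
      then have "ennreal (2 * K * A - e / 2) < ennreal (2 * K * A)" by (rule ennreal_lessI)
      also note fatou
      finally have "ennreal (2 * K * A - e / 2) < liminf I" .
      from less_LiminfD[OF this] show ?thesis by eventually_elim simp
    qed
    show "\<forall>\<^sub>F n in sequentially. J n < y"
      using ev1 ev2
    proof eventually_elim
      case (elim n)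
      have "I n + J n \<noteq> top" using IJ[of n] by (auto simp: top_unique)
      then obtain i j where ij: "I n = ennreal i" "0 \<le> i" "J n = ennreal j" "0 \<le> j"
        by (cases "I n"; cases "J n") auto
      have "0 \<le> K * (c n + 1) * A" using K A c(2)[of n] by simp
      then have "i + j \<le> K * (c n + 1) * A"
        using IJ[of n] ij by (simp flip: ennreal_plus)
      moreover have "2 * K * A - e / 2 \<le> i" using elim(2) ij by (simp add: ennreal_le_iff)
      ultimately have "j \<le> e" using elim(1) by linarith
      then show ?case using ij e(2) by (auto intro: order_le_less_trans ennreal_leI)
    qed
  qed simp
  then show ?thesis by (simp add: J_def[abs_def])
qed

subsection \<open>The norm of \<open>RM(p,q)\<close>\<close>

definition radial_norm :: "ennreal \<Rightarrow> (complex \<Rightarrow> complex) \<Rightarrow> real \<Rightarrow> ennreal"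
  where "radial_norm p f t =
    (if p = \<infinity> then SUP r \<in> {0..<1}. ennreal (cmod (f (of_real r * cis t)))
     else Lq_norm (restrict_space lborel {0..<1}) (enn2real p) (\<lambda>r. ennreal (cmod (f (of_real r * cis t)))))"

lemma enn2real_ge_1: "1 \<le> p \<Longrightarrow> p \<noteq> \<infinity> \<Longrightarrow> 1 \<le> enn2real p"
  by (cases p) auto

text \<open>The exponent \<open>q / enn2real p\<close> in \<open>rho\<close> is the outer power q
  applied to a p-th root.\<close>

lemma rho_eq_Lq_norm:
  assumes p: "1 \<le> p" and q: "1 \<le> q"
  shows "rho p q f = enn_powr (ennreal (1 / (2 * pi))) (1 / q) *
           Lq_norm (restrict_space lborel {0..2 * pi}) q (radial_norm p f)"
proof -
  have "enn_powr (radial_norm p f t) q =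
     (if p = \<infinity> then enn_powr (SUP r \<in> {0..<1::real}. ennreal (cmod (f (of_real r * cis t)))) q
      else enn_powr (\<integral>\<^sup>+ r \<in> {0..<1::real}. ennreal (cmod (f (of_real r * cis t)) powr enn2real p) \<partial>lborel)
             (q / enn2real p))" for t
    by (simp add: radial_norm_def Lq_norm_def enn_powr_powr nn_integral_restrict_space)
  then show ?thesis
    by (simp add: rho_def Lq_norm_def enn_powr_mult nn_integral_restrict_space)
qed

lemma ray_in_disc: "r \<in> {0..<1} \<Longrightarrow> of_real r * cis t \<in> ball 0 1"
  by (simp add: norm_mult)

lemma continuous_on_radial:
  assumes "continuous_on (ball 0 1) f"
  shows "continuous_on {0..<1} (\<lambda>r. f (of_real r * cis t))"
  by (rule continuous_on_compose2[OF assms]) (auto intro!: continuous_intros simp: norm_mult)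

lemma continuous_on_angular:
  assumes "continuous_on (ball 0 1) f" "r \<in> {0..<1}"
  shows "continuous_on UNIV (\<lambda>t. f (of_real r * cis t))"
  by (rule continuous_on_compose2[OF assms(1)]) (use assms(2) in \<open>auto intro!: continuous_intros simp: norm_mult\<close>)

lemma measurable_radial:
  assumes "continuous_on (ball 0 1) f"
  shows "(\<lambda>r. f (of_real r * cis t)) \<in> borel_measurable (restrict_space lborel {0..<1})"
proof -
  have "(\<lambda>r. f (of_real r * cis t)) \<in> borel_measurable (restrict_space borel {0..<1})"
    by (rule borel_measurable_continuous_on_restrict[OF continuous_on_radial[OF assms]])
  moreover have "sets (restrict_space borel {0..<1::real}) = sets (restrict_space lborel {0..<1})"
    by (rule sets_restrict_space_cong) simp
  ultimately show ?thesis by (simp cong: measurable_cong_sets)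
qed

lemma measurable_ennreal_cmod_radial:
  assumes "continuous_on (ball 0 1) f"
  shows "(\<lambda>r. ennreal (cmod (f (of_real r * cis t)))) \<in> borel_measurable (restrict_space lborel {0..<1})"
  using measurable_radial[OF assms, of t] by measurable

text \<open>For \<open>p = \<infinity>\<close> a supremum of continuous functions of the angle, even
  an uncountable one, is lower semicontinuous and hence Borel. For finite p, extending
  \<open>f\<close> by 0 makes the integrand jointly Borel in radius and angle, so integrating out
  the radius preserves measurability.\<close>

lemma measurable_radial_norm:
  assumes f: "continuous_on (ball 0 1) f"
  shows "radial_norm p f \<in> borel_measurable borel"
proof (cases "p = \<infinity>")
  case True
  have "(\<lambda>t. SUP r \<in> {0..<1}. ennreal (cmod (f (of_real r * cis t)))) \<in> borel_measurable borel"
  proof (rule borel_measurableI_greater)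
    fix y :: ennreal
    have "open {t. y < ennreal (cmod (f (of_real r * cis t)))}" if "r \<in> {0..<1}" for r
      using continuous_on_angular[OF f that]
      by (intro open_Collect_less continuous_intros continuous_on_ennreal)
    then have "open (\<Union>r\<in>{0..<1}. {t. y < ennreal (cmod (f (of_real r * cis t)))})" by blast
    moreover have "{t \<in> space borel. y < (SUP r \<in> {0..<1}. ennreal (cmod (f (of_real r * cis t))))}
        = (\<Union>r\<in>{0..<1}. {t. y < ennreal (cmod (f (of_real r * cis t)))})"
      by (auto simp: less_SUP_iff)
    ultimately show "{t \<in> space borel. y < (SUP r \<in> {0..<1}. ennreal (cmod (f (of_real r * cis t))))} \<in> sets borel"
      by simp
  qed
  with True show ?thesis by (simp add: radial_norm_def[abs_def])
next
  case False
  define g where "g z = indicator (ball 0 1) z *\<^sub>R f z" for z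
  have [measurable]: "g \<in> borel_measurable borel"
    unfolding g_def by (rule borel_measurable_continuous_on_indicator[OF _ f]) simp
  have [measurable]: "cis \<in> borel_measurable borel"
    by (intro borel_measurable_continuous_onI continuous_intros)
  have "radial_norm p f t = enn_powr (\<integral>\<^sup>+ r. enn_powr (ennreal (cmod (g (of_real r * cis t)))) (enn2real p)
            * indicator {0..<1} r \<partial>lborel) (1 / enn2real p)" for t
    using False unfolding radial_norm_def Lq_norm_def
    by (simp add: nn_integral_restrict_space)
       (intro arg_cong2[where f = enn_powr] nn_integral_cong refl,
        auto simp: g_def norm_mult indicator_def)
  moreover have "(\<lambda>t. enn_powr (\<integral>\<^sup>+ r. enn_powr (ennreal (cmod (g (of_real r * cis t)))) (enn2real p)
            * indicator {0..<1} r \<partial>lborel) (1 / enn2real p)) \<in> borel_measurable borel"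
    by measurable
  ultimately show ?thesis by (simp cong: measurable_cong)
qed

lemma measurable_radial_norm_restrict:
  assumes f: "continuous_on (ball 0 1) f"
  shows "radial_norm p f \<in> borel_measurable (restrict_space lborel {0..2 * pi})"
  using measurable_radial_norm[OF f] by (intro measurable_restrict_space1) simp

lemma radial_norm_triangle:
  assumes p: "1 \<le> p" and f: "continuous_on (ball 0 1) f" and g: "continuous_on (ball 0 1) g"
  shows "radial_norm p (\<lambda>z. f z + g z) t \<le> radial_norm p f t + radial_norm p g t"
proof (cases "p = \<infinity>")
  case True
  have "ennreal (cmod (f (of_real r * cis t) + g (of_real r * cis t))) \<le>
    (SUP r \<in> {0..<1}. ennreal (cmod (f (of_real r * cis t)))) + (SUP r \<in> {0..<1}. ennreal (cmod (g (of_real r * cis t))))"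
    if "r \<in> {0..<1}" for r
  proof -
    have "ennreal (cmod (f (of_real r * cis t) + g (of_real r * cis t))) \<le>
       ennreal (cmod (f (of_real r * cis t))) + ennreal (cmod (g (of_real r * cis t)))"
      by (simp add: norm_triangle_ineq ennreal_leI flip: ennreal_plus)
    also have "\<dots> \<le> (SUP r \<in> {0..<1}. ennreal (cmod (f (of_real r * cis t)))) +
       (SUP r \<in> {0..<1}. ennreal (cmod (g (of_real r * cis t))))"
      using that by (intro add_mono SUP_upper)
    finally show ?thesis .
  qed
  then show ?thesis using True unfolding radial_norm_def by (auto intro: SUP_least)
next
  case False
  let ?M = "restrict_space lborel {0..<1::real}"
  note p1 = enn2real_ge_1[OF p False]
  have "Lq_norm ?M (enn2real p) (\<lambda>r. ennreal (cmod (f (of_real r * cis t) + g (of_real r * cis t))))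
     \<le> Lq_norm ?M (enn2real p) (\<lambda>r. ennreal (cmod (f (of_real r * cis t))) + ennreal (cmod (g (of_real r * cis t))))"
    using p1 by (intro Lq_norm_mono) (auto simp: norm_triangle_ineq ennreal_leI simp flip: ennreal_plus)
  also have "\<dots> \<le> Lq_norm ?M (enn2real p) (\<lambda>r. ennreal (cmod (f (of_real r * cis t)))) +
      Lq_norm ?M (enn2real p) (\<lambda>r. ennreal (cmod (g (of_real r * cis t))))"
    by (rule Lq_norm_triangle[OF _ _ p1]) (intro measurable_ennreal_cmod_radial f g)+
  finally show ?thesis using False by (simp add: radial_norm_def)
qed

lemma rho_triangle:
  assumes p: "1 \<le> p" and q: "1 \<le> q" and f: "continuous_on (ball 0 1) f" and g: "continuous_on (ball 0 1) g"
  shows "rho p q (\<lambda>z. f z + g z) \<le> rho p q f + rho p q g"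
proof -
  let ?M = "restrict_space lborel {0..2 * pi}"
  have "Lq_norm ?M q (radial_norm p (\<lambda>z. f z + g z)) \<le> Lq_norm ?M q (\<lambda>t. radial_norm p f t + radial_norm p g t)"
    using q by (intro Lq_norm_mono radial_norm_triangle p f g) auto
  also have "\<dots> \<le> Lq_norm ?M q (radial_norm p f) + Lq_norm ?M q (radial_norm p g)"
    by (intro Lq_norm_triangle measurable_radial_norm_restrict f g q)
  finally show ?thesis
    unfolding rho_eq_Lq_norm[OF p q] distrib_left[symmetric] by (rule mult_left_mono) simp
qed

text \<open>The ray [0, 1) and the normalised circle both have total mass 1. Uniform approximation
  on the disc therefore gives approximation in the norm with the same error.\<close>

lemma rho_le_bound:
  assumes p: "1 \<le> p" and q: "1 \<le> q" and B: "\<And>z. z \<in> ball 0 1 \<Longrightarrow> cmod (f z) \<le> B"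
  shows "rho p q f \<le> ennreal B"
proof -
  have B': "cmod (f (of_real r * cis t)) \<le> B" if "r \<in> {0..<1}" for r t
    using B ray_in_disc[OF that] by blast
  have "radial_norm p f t \<le> ennreal B" for t
  proof (cases "p = \<infinity>")
    case True
    then show ?thesis using B' by (auto simp: radial_norm_def intro!: SUP_least ennreal_leI)
  next
    case False
    note p1 = enn2real_ge_1[OF p False]
    have "radial_norm p f t \<le> Lq_norm (restrict_space lborel {0..<1::real}) (enn2real p) (\<lambda>r. ennreal B)"
      using False p1 B' by (auto simp: radial_norm_def space_restrict_space intro!: Lq_norm_mono ennreal_leI)
    also have "\<dots> = ennreal B"
      using p1 by (simp add: Lq_norm_const space_restrict_space emeasure_restrict_space enn_powr_def)
    finally show ?thesis .
  qed
  then have "rho p q f \<le> enn_powr (ennreal (1 / (2 * pi))) (1 / q) *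
           Lq_norm (restrict_space lborel {0..2 * pi}) q (\<lambda>t. ennreal B)"
    unfolding rho_eq_Lq_norm[OF p q] using q by (intro mult_left_mono Lq_norm_mono) auto
  also have "\<dots> = ennreal B * enn_powr (ennreal (1 / (2 * pi)) * ennreal (2 * pi)) (1 / q)"
    using q unfolding enn_powr_mult
    by (simp add: Lq_norm_const space_restrict_space emeasure_restrict_space ac_simps del: enn_powr_ennreal)
  also have "ennreal (1 / (2 * pi)) * ennreal (2 * pi) = ennreal 1"
    by (subst ennreal_mult[symmetric]) auto
  finally show ?thesis by (simp add: enn_powr_def)
qed

text \<open>One ray with vanishing radial norm suffices: the zeros of \<open>h\<close> have full
  measure on it, hence accumulate at 0, and the identity theorem applies.\<close>

lemma rho_eq_0_imp_zero:
  assumes p: "1 \<le> p" and q: "1 \<le> q" and h: "h holomorphic_on ball 0 1" and z0: "rho p q h = 0"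
    and z: "z \<in> ball 0 1"
  shows "h z = 0"
proof -
  have hc: "continuous_on (ball 0 1) h" using h by (rule holomorphic_on_imp_continuous_on)
  let ?M = "restrict_space lborel {0..2 * pi}"
  have "enn_powr (ennreal (1 / (2 * pi))) (1 / q) \<noteq> 0" by (simp add: ennreal_eq_0_iff)
  then have "Lq_norm ?M q (radial_norm p h) = 0"
    using z0 unfolding rho_eq_Lq_norm[OF p q] by simp
  then have "AE t in ?M. radial_norm p h t = 0"
    by (rule Lq_norm_eq_0_AE[OF measurable_radial_norm_restrict[OF hc]])
  moreover have "emeasure ?M (space ?M) \<noteq> 0"
    by (simp add: space_restrict_space emeasure_restrict_space ennreal_eq_0_iff not_le)
  ultimately have "\<exists>t. radial_norm p h t = 0"
    by (intro eventually_happens'[of "ae_filter ?M"]) (simp_all only: ae_filter_eq_bot_iff simp_thms)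
  then obtain t where t: "radial_norm p h t = 0" by blast
  have AE0: "AE r in restrict_space lborel {0..<1}. h (of_real r * cis t) = 0"
  proof (cases "p = \<infinity>")
    case True
    then show ?thesis
      using t by (intro AE_I2) (auto simp: radial_norm_def space_restrict_space SUP_eq_iff bot_ennreal)
  next
    case False
    then have "AE r in restrict_space lborel {0..<1}. ennreal (cmod (h (of_real r * cis t))) = 0"
      using t by (intro Lq_norm_eq_0_AE measurable_ennreal_cmod_radial hc) (simp add: radial_norm_def)
    then show ?thesis by eventually_elim (simp add: ennreal_eq_0_iff)
  qed
  define Z where "Z = {w \<in> ball 0 1. h w = 0}"
  have "0 islimpt Z"
    unfolding islimpt_approachable
  proof (intro allI impI)
    fix e :: real assume "0 < e"
    define d where "d = min e 1"
    have d: "0 < d" "d \<le> e" "d \<le> 1" using \<open>0 < e\<close> by (auto simp: d_def)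
    have "\<exists>r\<in>{0<..<d}. h (of_real r * cis t) = 0"
    proof (rule ccontr)
      assume "\<not> ?thesis"
      then have ne: "\<And>r. r \<in> {0<..<d} \<Longrightarrow> h (of_real r * cis t) \<noteq> 0" by blast
      have "AE r in lborel. r \<in> {0..<1} \<longrightarrow> h (of_real r * cis t) = 0"
        using AE0 by (subst (asm) AE_restrict_space_iff) auto
      then have "AE r in lborel. r \<notin> {0<..<d}"
        by eventually_elim (use ne d in fastforce)
      then have "emeasure lborel {0<..<d} = 0"
        by (subst (asm) AE_iff_measurable[where N = "{0<..<d}"]) auto
      then show False using d by (simp add: ennreal_eq_0_iff)
    qed
    then obtain r where r: "0 < r" "r < d" "h (of_real r * cis t) = 0" by auto
    then show "\<exists>w\<in>Z. w \<noteq> 0 \<and> dist w 0 < e"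
      using d by (intro bexI[of _ "of_real r * cis t"]) (auto simp: Z_def norm_mult)
  qed
  have Z: "Z \<subseteq> ball 0 1" "\<And>w. w \<in> Z \<Longrightarrow> h w = 0" by (simp_all add: Z_def subset_iff)
  show ?thesis
    by (rule analytic_continuation[of h "ball 0 1" Z 0 z, OF h open_ball connected_ball Z(1) _ \<open>0 islimpt Z\<close> Z(2) z]) simp
qed

lemma Metric_space_RM:
  assumes p: "1 \<le> p" and q: "1 \<le> q"
  shows "Metric_space (RM p q) (RM_dist p q)"
proof -
  have cont: "continuous_on (ball 0 1) f" if "f \<in> RM p q" for f
    using that by (auto simp: RM_def intro: holomorphic_on_imp_continuous_on)
  have sym: "rho p q (\<lambda>z. f z - g z) = rho p q (\<lambda>z. g z - f z)" for f g
    by (simp only: rho_def norm_minus_commute[of "f z" "g z" for z])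
  \<comment> \<open>Since \<open>enn2real\<close> sends infinity to 0, finiteness has to be secured
    before \<open>RM_dist\<close> can separate points or satisfy the triangle inequality.\<close>
  have fin: "rho p q (\<lambda>z. f z - g z) < \<infinity>" if "f \<in> RM p q" "g \<in> RM p q" for f g
  proof -
    have "rho p q (\<lambda>z. f z + - g z) \<le> rho p q f + rho p q (\<lambda>z. - g z)"
      using that by (intro rho_triangle p q cont continuous_intros)
    also have "rho p q (\<lambda>z. - g z) = rho p q g" by (simp only: rho_def norm_minus_cancel)
    also have "rho p q f + rho p q g < \<infinity>" using that by (simp add: RM_def)
    finally show ?thesis by simp
  qed
  have zero: "f = g" if fg: "f \<in> RM p q" "g \<in> RM p q" and d0: "RM_dist p q f g = 0" for f g
  proof (rule extensionalityI[of _ "ball 0 1"])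
    have r0: "rho p q (\<lambda>z. f z - g z) = 0"
      using d0 fin[OF fg] by (auto simp: RM_dist_def enn2real_eq_0_iff)
    have "(\<lambda>z. f z - g z) holomorphic_on ball 0 1"
      using fg by (auto simp: RM_def intro!: holomorphic_intros)
    from rho_eq_0_imp_zero[OF p q this r0] show "f z = g z" if "z \<in> ball 0 1" for z
      using that by simp
  qed (use fg in \<open>auto simp: RM_def\<close>)
  show ?thesis
  proof
    show "0 \<le> RM_dist p q f g" for f g by (simp add: RM_dist_def)
    show "RM_dist p q f g = RM_dist p q g f" for f g unfolding RM_dist_def by (subst sym) simp
    show "RM_dist p q f g = 0 \<longleftrightarrow> f = g" if "f \<in> RM p q" "g \<in> RM p q" for f g
    proof
      assume "f = g"
      moreover have "rho p q (\<lambda>z. 0) \<le> ennreal 0" by (rule rho_le_bound[OF p q]) simp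
      ultimately show "RM_dist p q f g = 0" by (simp add: RM_dist_def)
    qed (rule zero[OF that])
    fix f g h assume RM: "f \<in> RM p q" "g \<in> RM p q" "h \<in> RM p q"
    have "rho p q (\<lambda>z. (f z - g z) + (g z - h z)) \<le> rho p q (\<lambda>z. f z - g z) + rho p q (\<lambda>z. g z - h z)"
      using RM by (intro rho_triangle p q cont continuous_intros)
    then have "rho p q (\<lambda>z. f z - h z) \<le> rho p q (\<lambda>z. f z - g z) + rho p q (\<lambda>z. g z - h z)"
      by simp
    then have "enn2real (rho p q (\<lambda>z. f z - h z)) \<le> enn2real (rho p q (\<lambda>z. f z - g z) + rho p q (\<lambda>z. g z - h z))"
      using fin RM by (intro enn2real_mono) auto
    then show "RM_dist p q f h \<le> RM_dist p q f g + RM_dist p q g h"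
      using fin RM by (simp add: RM_dist_def enn2real_plus)
  qed
qed

section \<open>Dilation along a ray\<close>

lemma dilation_cis: "of_real s * (of_real r * cis t) = of_real (s * r) * cis t"
  by simp

lemma continuous_on_dilate:
  fixes f :: "complex \<Rightarrow> complex"
  assumes "continuous_on (ball 0 1) f" "0 \<le> s" "s < 1"
  shows "continuous_on (ball 0 1) (\<lambda>z. f (of_real s * z))"
proof (rule continuous_on_compose2[OF assms(1)])
  have "cmod (of_real s * z) < 1" if "cmod z < 1" for z :: complex
    using mult_strict_mono'[of s 1 "cmod z" 1] that assms by (simp add: norm_mult)
  then show "(\<lambda>z :: complex. of_real s * z) ` ball 0 1 \<subseteq> ball 0 1" by auto
qed (intro continuous_intros)

text \<open>The substitution contributes the factor 1 / s, and the dilated ray [0, s) lies inside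
  [0, 1).\<close>

lemma nn_integral_dilate_le:
  fixes \<phi> :: "real \<Rightarrow> ennreal"
  assumes \<phi>: "\<phi> \<in> borel_measurable (restrict_space lborel {0..<1})" and s: "0 < s" "s \<le> 1"
  shows "(\<integral>\<^sup>+r. \<phi> (s * r) \<partial>restrict_space lborel {0..<1}) \<le> ennreal (1 / s) * (\<integral>\<^sup>+r. \<phi> r \<partial>restrict_space lborel {0..<1})"
proof -
  have [measurable]: "(\<lambda>r. \<phi> r * indicator {0..<1} r) \<in> borel_measurable lborel"
    using \<phi> by (subst (asm) borel_measurable_restrict_space_iff_ennreal) auto
  have "(\<integral>\<^sup>+r. \<phi> (s * r) \<partial>restrict_space lborel {0..<1}) = (\<integral>\<^sup>+r. \<phi> (s * r) * indicator {0..<1} r \<partial>lborel)"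
    by (simp add: nn_integral_restrict_space)
  also have "\<dots> \<le> (\<integral>\<^sup>+r. \<phi> (s * r) * indicator {0..<1} (s * r) \<partial>lborel)"
  proof (intro nn_integral_mono mult_left_mono)
    fix r :: real
    have "s * r \<in> {0..<1}" if "r \<in> {0..<1}"
    proof -
      have "s * r \<le> 1 * r" using that s by (intro mult_right_mono) auto
      then show ?thesis using that s by auto
    qed
    then show "indicator {0..<1} r \<le> (indicator {0..<1} (s * r) :: ennreal)"
      by (auto simp: indicator_def)
  qed simp
  also have "\<dots> = ennreal (1 / s) * (\<integral>\<^sup>+r. \<phi> r * indicator {0..<1} r \<partial>lborel)"
    using s nn_integral_real_affine[of "\<lambda>r. \<phi> r * indicator {0..<1} r" s 0]
    by (simp add: mult.assoc[symmetric] flip: ennreal_mult)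
  finally show ?thesis by (simp add: nn_integral_restrict_space)
qed

text \<open>A supremum does not grow under dilation; the L^p norm grows by at most (1 / s)^(1 / p),
  and this is at most 2 because 1 / s <= 2 and 1 / p <= 1. One constant serves all p.\<close>

lemma radial_norm_dilate_le:
  assumes p: "1 \<le> p" and f: "continuous_on (ball 0 1) f" and s: "1 / 2 \<le> s" "s < 1"
  shows "radial_norm p (\<lambda>z. f (of_real s * z)) t \<le> 2 * radial_norm p f t"
proof (cases "p = \<infinity>")
  case True
  have "radial_norm p (\<lambda>z. f (of_real s * z)) t \<le> radial_norm p f t"
    unfolding radial_norm_def dilation_cis if_P[OF True]
  proof (rule SUP_least)
    fix r :: real assume r: "r \<in> {0..<1}"
    have "s * r \<le> 1 * r" using r s by (intro mult_right_mono) auto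
    then have "s * r \<in> {0..<1}" using r s by auto
    then show "ennreal (cmod (f (of_real (s * r) * cis t))) \<le> (SUP r\<in>{0..<1}. ennreal (cmod (f (of_real r * cis t))))"
      by (rule SUP_upper)
  qed
  also have "\<dots> \<le> 2 * radial_norm p f t"
    using mult_right_mono[of 1 2 "radial_norm p f t"] by simp
  finally show ?thesis .
next
  case False
  note p1 = enn2real_ge_1[OF p False]
  let ?a = "enn2real p"
  let ?M = "restrict_space lborel {0..<1::real}"
  let ?\<phi> = "\<lambda>r. enn_powr (ennreal (cmod (f (of_real r * cis t)))) ?a"
  have m: "?\<phi> \<in> borel_measurable ?M" by (intro measurable_enn_powr measurable_ennreal_cmod_radial f)
  have "radial_norm p (\<lambda>z. f (of_real s * z)) t = enn_powr (\<integral>\<^sup>+r. ?\<phi> (s * r) \<partial>?M) (1 / ?a)"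
    using False unfolding radial_norm_def dilation_cis Lq_norm_def by simp
  also have "\<dots> \<le> enn_powr (ennreal (1 / s) * (\<integral>\<^sup>+r. ?\<phi> r \<partial>?M)) (1 / ?a)"
    using s p1 by (intro enn_powr_mono nn_integral_dilate_le[OF m]) auto
  also have "\<dots> = enn_powr (ennreal (1 / s)) (1 / ?a) * radial_norm p f t"
    using False unfolding enn_powr_mult radial_norm_def Lq_norm_def by simp
  also have "\<dots> \<le> 2 * radial_norm p f t"
  proof (rule mult_right_mono)
    have "(1 / s) powr (1 / ?a) \<le> 2 powr (1 / ?a)" using s p1 by (intro powr_mono2) (auto simp: field_simps)
    also have "\<dots> \<le> 2 powr 1" using p1 by (intro powr_mono) auto
    finally show "enn_powr (ennreal (1 / s)) (1 / ?a) \<le> 2"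
      using s by (simp flip: ennreal_numeral)
  qed simp
  finally show ?thesis .
qed

lemma radial_norm_dilate_diff_le:
  assumes p: "1 \<le> p" and f: "continuous_on (ball 0 1) f" and s: "1 / 2 \<le> s" "s < 1"
  shows "radial_norm p (\<lambda>z. f (of_real s * z) - f z) t \<le> 3 * radial_norm p f t"
proof -
  have "radial_norm p (\<lambda>z. f (of_real s * z) + - f z) t
      \<le> radial_norm p (\<lambda>z. f (of_real s * z)) t + radial_norm p (\<lambda>z. - f z) t"
    using s by (intro radial_norm_triangle p continuous_on_dilate continuous_intros f) auto
  also have "radial_norm p (\<lambda>z. - f z) t = radial_norm p f t" by (simp add: radial_norm_def)
  also have "radial_norm p (\<lambda>z. f (of_real s * z)) t + radial_norm p f t \<le> 2 * radial_norm p f t + radial_norm p f t"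
    by (intro add_right_mono radial_norm_dilate_le assms)
  also have "\<dots> = 3 * radial_norm p f t"
    using distrib_right[of 2 1 "radial_norm p f t"] by simp
  finally show ?thesis by simp
qed

subsection \<open>Dilation and polynomial approximation\<close>

text \<open>For \<open>p = \<infinity>\<close> the points s r and r are at distance at most 1 - s,
  so uniform continuity bounds the supremum. For finite p continuity inside the disc is enough: the
  p-th power integral of a dilate is at most 1 / s times that of \<open>f\<close>, and this factor
  tends to 1.\<close>

lemma radial_norm_dilate_tendsto_0:
  assumes p: "1 \<le> p" and f: "continuous_on (ball 0 1) f" and fin: "radial_norm p f t < \<infinity>"
    and uc: "p = \<infinity> \<Longrightarrow> uniformly_continuous_on {0..<1} (\<lambda>r. f (of_real r * cis t))"
    and s: "s \<longlonglongrightarrow> 1" "\<And>n :: nat. 1 / 2 \<le> s n" "\<And>n. s n < 1"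
  shows "(\<lambda>n. radial_norm p (\<lambda>z. f (of_real (s n) * z) - f z) t) \<longlonglongrightarrow> 0"
proof (cases "p = \<infinity>")
  case True
  show ?thesis
  proof (rule order_tendstoI)
    fix y :: ennreal assume "0 < y"
    then obtain e where e: "0 < e" "ennreal e < y"
      by (metis ennreal_0 ennreal_less_zero_iff dense ennreal_cases infinity_ennreal_def order_less_trans top.not_eq_extremum)
    obtain d where d: "0 < d" "\<And>r r'. r \<in> {0..<1} \<Longrightarrow> r' \<in> {0..<1} \<Longrightarrow> dist r' r < d \<Longrightarrow>
        dist (f (of_real r' * cis t)) (f (of_real r * cis t)) < e"
      using uc[OF True] e(1) unfolding uniformly_continuous_on_def by metis
    have "\<forall>\<^sub>F n in sequentially. 1 - d < s n"
      using d(1) by (intro order_tendstoD(1)[OF s(1)]) simp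
    then show "\<forall>\<^sub>F n in sequentially. radial_norm p (\<lambda>z. f (of_real (s n) * z) - f z) t < y"
    proof eventually_elim
      case (elim n)
      have "ennreal (cmod (f (of_real (s n) * (of_real r * cis t)) - f (of_real r * cis t))) \<le> ennreal e"
        if r: "r \<in> {0..<1}" for r
      proof -
        have "0 \<le> s n" using s(2)[of n] by linarith
        have "s n * r \<le> 1 * r" using r s(3)[of n] by (intro mult_right_mono) auto
        then have sr: "s n * r \<in> {0..<1}" using r \<open>0 \<le> s n\<close> by auto
        have "dist (s n * r) r = (1 - s n) * r"
          using \<open>s n * r \<le> 1 * r\<close> by (simp add: dist_real_def algebra_simps)
        also have "\<dots> \<le> (1 - s n) * 1" using r s(3)[of n] by (intro mult_left_mono) auto
        finally have "dist (s n * r) r < d" using elim by simp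
        from d(2)[OF r sr this] show ?thesis
          unfolding dilation_cis dist_norm by (intro ennreal_leI less_imp_le)
      qed
      then have "radial_norm p (\<lambda>z. f (of_real (s n) * z) - f z) t \<le> ennreal e"
        unfolding radial_norm_def if_P[OF True] by (intro SUP_least)
      with e(2) show ?case by simp
    qed
  qed simp
next
  case False
  note p1 = enn2real_ge_1[OF p False]
  let ?a = "enn2real p"
  let ?M = "restrict_space lborel {0..<1::real}"
  have s0: "0 < s n" for n using s(2)[of n] by linarith
  have pw: "enn_powr (ennreal (cmod w)) ?a = ennreal (cmod w powr ?a)" for w by simp
  have cn: "continuous_on (ball 0 1) (\<lambda>z. f (of_real (s n) * z))" for n
    using s0[of n] s(3)[of n] by (intro continuous_on_dilate f) auto
  have "(\<lambda>n. \<integral>\<^sup>+r. ennreal (cmod (f (of_real (s n) * (of_real r * cis t)) - f (of_real r * cis t)) powr ?a) \<partial>?M) \<longlonglongrightarrow> 0"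
  proof (rule nn_integral_powr_diff_tendsto_0[where c = "\<lambda>n. 1 / s n"])
    show "(\<lambda>r. f (of_real (s n) * (of_real r * cis t))) \<in> borel_measurable ?M" for n
      by (rule measurable_radial[OF cn])
    show "(\<lambda>r. f (of_real r * cis t)) \<in> borel_measurable ?M"
      by (rule measurable_radial[OF f])
    show "(\<lambda>n. f (of_real (s n) * (of_real r * cis t))) \<longlonglongrightarrow> f (of_real r * cis t)" if "r \<in> space ?M" for r
    proof -
      have "of_real r * cis t \<in> ball 0 1" using that by (intro ray_in_disc) (simp add: space_restrict_space)
      then have "isCont f (of_real r * cis t)" using f by (simp add: continuous_on_eq_continuous_at)
      moreover have "(\<lambda>n. of_real (s n) * (of_real r * cis t)) \<longlonglongrightarrow> of_real r * cis t"
        using tendsto_mult[OF tendsto_of_real[OF s(1)] tendsto_const[of "of_real r * cis t"]] by simp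
      ultimately show ?thesis by (rule isCont_tendsto_compose)
    qed
    have "enn_powr (radial_norm p f t) ?a < \<infinity>" using fin by simp
    moreover have "enn_powr (radial_norm p f t) ?a = (\<integral>\<^sup>+r. ennreal (cmod (f (of_real r * cis t)) powr ?a) \<partial>?M)"
      unfolding radial_norm_def if_not_P[OF False] using p1 by (subst enn_powr_Lq_norm) simp_all
    ultimately show "(\<integral>\<^sup>+r. ennreal (cmod (f (of_real r * cis t)) powr ?a) \<partial>?M) < \<infinity>"
      by (simp only:)
    show "(\<lambda>n. 1 / s n) \<longlonglongrightarrow> 1" using tendsto_divide[OF tendsto_const s(1), of 1] by simp
    show "0 \<le> 1 / s n" for n using s0[of n] by simp
    have m: "(\<lambda>r. ennreal (cmod (f (of_real r * cis t)) powr ?a)) \<in> borel_measurable ?M"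
      using measurable_radial[OF f, of t] by measurable
    show "(\<integral>\<^sup>+r. ennreal (cmod (f (of_real (s n) * (of_real r * cis t))) powr ?a) \<partial>?M)
        \<le> ennreal (1 / s n) * (\<integral>\<^sup>+r. ennreal (cmod (f (of_real r * cis t)) powr ?a) \<partial>?M)" for n
      unfolding dilation_cis using s0[of n] s(3)[of n] by (intro nn_integral_dilate_le[OF m]) auto
  qed (use p1 in simp)
  then have "(\<lambda>n. enn_powr (\<integral>\<^sup>+r. ennreal (cmod (f (of_real (s n) * (of_real r * cis t)) - f (of_real r * cis t)) powr ?a) \<partial>?M) (1 / ?a)) \<longlonglongrightarrow> 0"
    by (rule tendsto_enn_powr_0) (use p1 in simp)
  then show ?thesis
    using False by (simp add: radial_norm_def Lq_norm_def)
qed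

lemma RM_radial_norm_finite:
  assumes p: "1 \<le> p" and q: "1 \<le> q" and f: "f \<in> RM p q"
  shows "Lq_norm (restrict_space lborel {0..2 * pi}) q (radial_norm p f) < \<infinity>"
proof -
  have "rho p q f < \<infinity>" using f by (simp add: RM_def)
  then show ?thesis
    unfolding rho_eq_Lq_norm[OF p q]
    by (auto simp: ennreal_mult_less_top ennreal_eq_0_iff not_le)
qed

lemma RM_infinity_radial_limits:
  assumes q: "1 \<le> q" and f: "f \<in> RM \<infinity> q"
  shows "AE t in restrict_space lborel {0..2 * pi}.
           uniformly_continuous_on {0..<1} (\<lambda>r. f (of_real r * cis t))"
proof -
  let ?M = "restrict_space lborel {0..2 * pi}"
  let ?F = "radial_norm \<infinity> f"
  have hol: "f holomorphic_on ball 0 1" using f by (simp add: RM_def)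
  have cont: "continuous_on (ball 0 1) f" using hol by (rule holomorphic_on_imp_continuous_on)
  \<comment> \<open>L^q is contained in L^1 on a finite measure space, here through x <= 1 + x^q for
    q >= 1. This makes the radial maximal function an integrable majorant.\<close>
  have "(\<integral>\<^sup>+t. ?F t \<partial>?M) \<le> (\<integral>\<^sup>+t. 1 + enn_powr (?F t) q \<partial>?M)"
  proof (rule nn_integral_mono)
    fix t
    show "?F t \<le> 1 + enn_powr (?F t) q"
    proof (cases "?F t")
      case (real x)
      have "x \<le> 1 + x powr q"
      proof (cases "x \<le> 1")
        case False
        then have "x powr 1 \<le> x powr q" using q by (intro powr_mono) auto
        then show ?thesis using False by simp
      qed (simp add: add_increasing2)
      then show ?thesis using real by (simp flip: ennreal_1 ennreal_plus)
    qed simp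
  qed
  also have "\<dots> = emeasure ?M (space ?M) + enn_powr (Lq_norm ?M q ?F) q"
    using q measurable_radial_norm_restrict[OF cont, of \<infinity>]
    by (subst nn_integral_add) (auto simp: enn_powr_Lq_norm)
  also have "\<dots> < \<infinity>"
    using RM_radial_norm_finite[OF _ q f]
    by (simp add: emeasure_restrict_space space_restrict_space)
  finally have "(\<integral>\<^sup>+t\<in>{0..2 * pi}. ?F t \<partial>lborel) < \<infinity>"
    by (simp add: nn_integral_restrict_space)
  then have "AE t in lborel. t \<in> {0..2 * pi} \<longrightarrow>
           uniformly_continuous_on {0..<1} (\<lambda>r. f (of_real r * cis t))"
    by (intro radial_uniformly_continuous_AE[OF hol measurable_radial_norm[OF cont]])
       (auto simp: radial_norm_def intro: SUP_upper2)
  then show ?thesis by (subst AE_restrict_space_iff) auto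
qed

lemma rho_dilate_tendsto_0:
  assumes p: "1 \<le> p" and q: "1 \<le> q" and f: "f \<in> RM p q"
    and s: "s \<longlonglongrightarrow> 1" "\<And>n :: nat. 1 / 2 \<le> s n" "\<And>n. s n < 1"
  shows "(\<lambda>n. rho p q (\<lambda>z. f (of_real (s n) * z) - f z)) \<longlonglongrightarrow> 0"
proof -
  let ?M = "restrict_space lborel {0..2 * pi}"
  let ?c = "enn_powr (ennreal (1 / (2 * pi))) (1 / q)"
  have cont: "continuous_on (ball 0 1) f"
    using f by (auto simp: RM_def intro: holomorphic_on_imp_continuous_on)
  have cn: "continuous_on (ball 0 1) (\<lambda>z. f (of_real (s n) * z) - f z)" for n
    using s(2)[of n] s(3)[of n] by (intro continuous_intros continuous_on_dilate cont) auto
  note m = measurable_radial_norm_restrict[OF cont, of p]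
  have "(\<lambda>n. Lq_norm ?M q (radial_norm p (\<lambda>z. f (of_real (s n) * z) - f z))) \<longlonglongrightarrow> 0"
  proof (rule Lq_norm_dominated_convergence[where G = "\<lambda>t. 3 * radial_norm p f t"])
    show "Lq_norm ?M q (\<lambda>t. 3 * radial_norm p f t) < \<infinity>"
      using q RM_radial_norm_finite[OF p q f] by (simp add: Lq_norm_cmult[OF m] ennreal_mult_less_top)
    have "AE t in ?M. radial_norm p f t < \<infinity>"
      by (rule Lq_norm_less_top_AE[OF m RM_radial_norm_finite[OF p q f]])
    \<comment> \<open>Stated as an implication, so that finite and infinite p share one dominated
      convergence argument.\<close>
    moreover have "AE t in ?M. p = \<infinity> \<longrightarrow> uniformly_continuous_on {0..<1} (\<lambda>r. f (of_real r * cis t))"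
      using RM_infinity_radial_limits[OF q] f by (cases "p = \<infinity>") auto
    ultimately show "AE t in ?M. (\<lambda>n. radial_norm p (\<lambda>z. f (of_real (s n) * z) - f z) t) \<longlonglongrightarrow> 0"
      by eventually_elim (intro radial_norm_dilate_tendsto_0 p cont s, auto)
  qed (use q m in \<open>auto intro: measurable_radial_norm_restrict cn radial_norm_dilate_diff_le p cont s\<close>)
  then have "(\<lambda>n. ?c * Lq_norm ?M q (radial_norm p (\<lambda>z. f (of_real (s n) * z) - f z))) \<longlonglongrightarrow> ?c * 0"
    by (intro ennreal_tendsto_cmult) (simp_all add: less_top[symmetric])
  then show ?thesis unfolding rho_eq_Lq_norm[OF p q] by simp
qed

text \<open>Horner's scheme: the constant coefficient and the remaining polynomial each receive half
  of the tolerance, since multiplication by z with |z| < 1 does not enlarge an error. With a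
  countable dense \<open>S\<close> only countably many polynomials occur.\<close>

lemma poly_approx_coeffs:
  fixes S :: "complex set"
  assumes S: "closure S = UNIV" and "0 < e"
  shows "\<exists>xs\<in>lists S. \<forall>z\<in>ball 0 1. cmod (poly P z - poly (Poly xs) z) \<le> e"
  using \<open>0 < e\<close>
proof (induction P arbitrary: e)
  case 0
  then show ?case by (intro bexI[of _ "[]"]) auto
next
  case (pCons a P)
  obtain b where b: "b \<in> S" "dist b a < e / 2"
    using S pCons.prems by (metis UNIV_I closure_approachable half_gt_zero)
  obtain xs where xs: "xs \<in> lists S" "\<And>z. z \<in> ball 0 1 \<Longrightarrow> cmod (poly P z - poly (Poly xs) z) \<le> e / 2"
    using pCons.IH[OF half_gt_zero[OF pCons.prems]] by blast
  have "cmod (poly (pCons a P) z - poly (Poly (b # xs)) z) \<le> e" if z: "z \<in> ball 0 1" for z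
  proof -
    have "poly (pCons a P) z - poly (Poly (b # xs)) z = (a - b) + z * (poly P z - poly (Poly xs) z)"
      by (simp add: algebra_simps)
    then have "cmod (poly (pCons a P) z - poly (Poly (b # xs)) z)
        \<le> cmod (a - b) + cmod z * cmod (poly P z - poly (Poly xs) z)"
      by (metis norm_mult norm_triangle_ineq)
    also have "\<dots> \<le> e / 2 + 1 * (e / 2)"
      using b z xs(2)[OF z] by (intro add_mono mult_mono) (auto simp: dist_norm norm_minus_commute)
    finally show ?thesis by simp
  qed
  then show ?case using b(1) xs(1) by (intro bexI[of _ "b # xs"]) auto
qed

text \<open>Taylor sections of \<open>f\<close> at 0, rescaled by s: absolute convergence at radius
  s < 1 bounds the tails simultaneously for all z in the disc.\<close>

lemma dilate_poly_approx:
  assumes f: "f holomorphic_on ball 0 1" and s: "0 \<le> s" "s < 1" and "0 < e"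
  obtains P where "\<And>z. z \<in> ball 0 1 \<Longrightarrow> cmod (f (of_real s * z) - poly P z) \<le> e"
proof -
  define a where "a n = (deriv ^^ n) f 0 / fact n" for n
  have sums: "(\<lambda>n. a n * w ^ n) sums f w" if "w \<in> ball 0 1" for w
    using holomorphic_power_series[OF f that] by (simp add: a_def)
  \<comment> \<open>A point strictly between s and 1; convergence there gives absolute convergence
    at s.\<close>
  define c where "c = (s + 1) / 2"
  have "summable (\<lambda>n. a n * of_real c ^ n)"
    using s by (intro sums_summable[OF sums]) (simp add: c_def)
  then have summ: "summable (\<lambda>n. cmod (a n * of_real s ^ n))"
    by (rule powser_insidea) (use s in \<open>simp add: c_def\<close>)
  obtain N where N: "\<And>n. n \<ge> N \<Longrightarrow> norm (\<Sum>i. cmod (a (i + n) * of_real s ^ (i + n))) < e"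
    using suminf_exist_split[OF \<open>0 < e\<close> summ] by blast
  define P where "P = (\<Sum>n<N. monom (a n * of_real s ^ n) n)"
  have P: "poly P z = (\<Sum>n<N. a n * (of_real s * z) ^ n)" for z
    by (simp add: P_def poly_sum poly_monom power_mult_distrib mult.assoc)
  have "cmod (f (of_real s * z) - poly P z) \<le> e" if z: "z \<in> ball 0 1" for z
  proof -
    have "cmod (of_real s * z) \<le> 1 * cmod z" unfolding norm_mult using s by (intro mult_right_mono) auto
    then have sz: "of_real s * z \<in> ball 0 1" using z by simp
    have tail: "(\<lambda>n. a (n + N) * (of_real s * z) ^ (n + N)) sums (f (of_real s * z) - poly P z)"
      using sums_split_initial_segment[OF sums[OF sz], of N] by (simp add: P)
    have le: "cmod (a (n + N) * (of_real s * z) ^ (n + N)) \<le> cmod (a (n + N) * of_real s ^ (n + N))" for n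
    proof -
      have "cmod z ^ (n + N) \<le> 1" using z by (intro power_le_one) auto
      then have "cmod (a (n + N) * of_real s ^ (n + N)) * cmod z ^ (n + N) \<le> cmod (a (n + N) * of_real s ^ (n + N))"
        by (intro mult_left_le) auto
      then show ?thesis by (simp only: power_mult_distrib norm_mult norm_power mult.assoc)
    qed
    have "cmod (f (of_real s * z) - poly P z) = cmod (\<Sum>n. a (n + N) * (of_real s * z) ^ (n + N))"
      using tail by (simp add: sums_iff)
    also have "\<dots> \<le> (\<Sum>n. cmod (a (n + N) * of_real s ^ (n + N)))"
      using le summ by (intro norm_suminf_le) (auto intro: summable_ignore_initial_segment[of "\<lambda>n. cmod (a n * of_real s ^ n)"])
    also have "\<dots> \<le> e" using N[of N] by simp
    finally show ?thesis .
  qed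
  then show ?thesis by (rule that)
qed

lemma poly_in_RM:
  assumes p: "1 \<le> p" and q: "1 \<le> q"
  shows "restrict (poly P) (ball 0 1) \<in> RM p q"
proof -
  have "bounded (poly P ` cball 0 1)"
    by (intro compact_imp_bounded compact_continuous_image continuous_intros) auto
  then obtain B where "\<And>z. z \<in> cball 0 1 \<Longrightarrow> cmod (poly P z) \<le> B"
    unfolding bounded_iff by (metis imageI)
  then have "rho p q (restrict (poly P) (ball 0 1)) \<le> ennreal B"
    by (intro rho_le_bound p q) auto
  then have "rho p q (restrict (poly P) (ball 0 1)) < \<infinity>" by (rule order_le_less_trans) simp
  moreover have "restrict (poly P) (ball 0 1) holomorphic_on ball 0 1"
    by (rule holomorphic_transform[of "poly P"]) (auto intro!: holomorphic_intros)
  ultimately show ?thesis by (simp add: RM_def)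
qed

lemma RM_poly_dense:
  fixes S :: "complex set"
  assumes p: "1 \<le> p" and q: "1 \<le> q" and f: "f \<in> RM p q" and S: "closure S = UNIV" and "0 < e"
  shows "\<exists>xs\<in>lists S. RM_dist p q f (restrict (poly (Poly xs)) (ball 0 1)) < e"
proof -
  have hol: "f holomorphic_on ball 0 1" using f by (simp add: RM_def)
  \<comment> \<open>The shift by two makes the sequence start at 1/2, the smallest dilation factor
    covered by the bounds.\<close>
  define s where "s n = 1 - 1 / real (Suc (Suc n))" for n
  have "(\<lambda>n. 1 - 1 / real (Suc (Suc n))) \<longlonglongrightarrow> 1 - 0"
    by (intro tendsto_intros LIMSEQ_Suc[OF LIMSEQ_Suc[OF lim_1_over_n]])
  then have s: "s \<longlonglongrightarrow> 1" "\<And>n. 1 / 2 \<le> s n" "\<And>n. s n < 1"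
    by (auto simp: s_def[abs_def] field_simps)
  \<comment> \<open>Three errors of size e / 4, from the dilation, the Taylor section and the
    coefficients, leave a strict margin below e.\<close>
  have "\<forall>\<^sub>F n in sequentially. rho p q (\<lambda>z. f (of_real (s n) * z) - f z) < ennreal (e / 4)"
    using \<open>0 < e\<close> by (intro order_tendstoD(2)[OF rho_dilate_tendsto_0[OF p q f s]]) simp
  then obtain n where n: "rho p q (\<lambda>z. f (of_real (s n) * z) - f z) < ennreal (e / 4)"
    using eventually_happens'[OF sequentially_bot] by blast
  have sn: "0 \<le> s n" "s n < 1" using s(2)[of n] s(3)[of n] by auto
  obtain P where P: "\<And>z. z \<in> ball 0 1 \<Longrightarrow> cmod (f (of_real (s n) * z) - poly P z) \<le> e / 4"
    using dilate_poly_approx[OF hol sn, of "e / 4"] \<open>0 < e\<close> by auto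
  obtain xs where xs: "xs \<in> lists S" "\<And>z. z \<in> ball 0 1 \<Longrightarrow> cmod (poly P z - poly (Poly xs) z) \<le> e / 4"
    using poly_approx_coeffs[OF S divide_pos_pos[OF \<open>0 < e\<close> zero_less_numeral], of P] by blast
  define Q where "Q = restrict (poly (Poly xs)) (ball 0 1)"
  have Qhol: "Q holomorphic_on ball 0 1" using poly_in_RM[OF p q] by (simp add: Q_def RM_def)
  have cont: "continuous_on (ball 0 1) f" "continuous_on (ball 0 1) Q"
    using hol Qhol by (auto intro: holomorphic_on_imp_continuous_on)
  have "rho p q (\<lambda>z. (f (of_real (s n) * z) - Q z) + - (f (of_real (s n) * z) - f z))
     \<le> rho p q (\<lambda>z. f (of_real (s n) * z) - Q z) + rho p q (\<lambda>z. - (f (of_real (s n) * z) - f z))"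
    by (intro rho_triangle p q continuous_intros continuous_on_dilate cont sn)
  also have "rho p q (\<lambda>z. - (f (of_real (s n) * z) - f z)) = rho p q (\<lambda>z. f (of_real (s n) * z) - f z)"
    by (simp only: rho_def norm_minus_cancel)
  also have "rho p q (\<lambda>z. f (of_real (s n) * z) - Q z) \<le> ennreal (e / 2)"
  proof (rule rho_le_bound[OF p q])
    fix z :: complex assume z: "z \<in> ball 0 1"
    have "cmod ((f (of_real (s n) * z) - poly P z) + (poly P z - poly (Poly xs) z)) \<le> e / 4 + e / 4"
      by (intro norm_triangle_le add_mono P xs(2) z)
    then show "cmod (f (of_real (s n) * z) - Q z) \<le> e / 2" using z by (simp add: Q_def)
  qed
  also have "ennreal (e / 2) + rho p q (\<lambda>z. f (of_real (s n) * z) - f z) \<le> ennreal (e / 2) + ennreal (e / 4)"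
    using n by (intro add_left_mono) simp
  also have "\<dots> = ennreal (3 * e / 4)" using \<open>0 < e\<close> by (simp flip: ennreal_plus)
  finally have "rho p q (\<lambda>z. f z - Q z) \<le> ennreal (3 * e / 4)" by simp
  then have "RM_dist p q f Q \<le> 3 * e / 4"
    unfolding RM_dist_def using \<open>0 < e\<close> by (intro enn2real_leI) auto
  with xs(1) \<open>0 < e\<close> show ?thesis unfolding Q_def by (intro bexI[of _ xs]) auto
qed

theorem proposition2p13:
  fixes p :: ennreal and q :: real
  assumes "1 \<le> p" and "1 \<le> q"
  shows "disc_polynomials \<subseteq> RM p q
    \<and> RM_topology p q closure_of disc_polynomials = RM p q
    \<and> separable_space (RM_topology p q)"
proof -
  interpret Metric_space "RM p q" "RM_dist p q" by (rule Metric_space_RM[OF assms])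
  obtain S :: "complex set" where S1: "countable S" and
    S': "\<And>X. open X \<Longrightarrow> X \<noteq> {} \<Longrightarrow> \<exists>d\<in>S. d \<in> X"
    by (rule countable_dense_setE) blast
  have S2: "closure S = UNIV"
  proof -
    have "x \<in> closure S" for x
      unfolding closure_approachable
    proof (intro allI impI)
      fix e :: real assume "0 < e"
      then have "ball x e \<noteq> {}" by simp
      from S'[OF open_ball this] show "\<exists>y\<in>S. dist y x < e" by (auto simp: dist_commute)
    qed
    then show ?thesis by blast
  qed
  define C where "C = (\<lambda>xs. restrict (poly (Poly xs)) (ball 0 1 :: complex set)) ` lists S"
  have C: "countable C" "C \<subseteq> disc_polynomials"
    unfolding C_def disc_polynomials_def using S1 by (auto intro: countable_lists)
  have sub: "disc_polynomials \<subseteq> RM p q"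
    unfolding disc_polynomials_def using poly_in_RM[OF assms] by blast
  have CRM: "C \<subseteq> RM p q" using C(2) sub by blast
  have "\<exists>y\<in>C. RM_dist p q f y < e" if "f \<in> RM p q" "0 < e" for f e
    using RM_poly_dense[OF assms that(1) S2 that(2)] by (auto simp: C_def)
  \<comment> \<open>Taking \<open>D\<close> to be \<open>disc_polynomials\<close> gives density, and
    taking it to be the countable set \<open>C\<close> gives separability.\<close>
  then have dense: "mtopology closure_of D = RM p q" if "C \<subseteq> D" "D \<subseteq> RM p q" for D
    unfolding metric_closure_of using that by (fastforce simp: mball_def)
  show ?thesis
    unfolding RM_topology_def separable_space_def topspace_mtopology
    using sub dense[OF C(2) sub] dense[OF order_refl CRM] C(1) CRM by blast
qed

end
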